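(* Let $\mathcal{X},\mathcal{Y}$ be Polish spaces, let $\mathcal{S}=\{p_1,\ldots,p_{|\mathcal{S}|}\}$ be a finite set of probability measures on $\mathcal{X}$, let $\mathcal{H}=\{h_i\}_{i=1}^M$ be a finite set of real-valued functions on the space $\mathcal{M}_1(\mathcal{X}\times\mathcal{Y})$ of joint distributions, and let $\theta\in\mathbb{R}^M$ be constraint levels such that there exists $Q_{Y|X}\in\mathcal{L}(\theta)$ with $\bar{I}(\mathcal{S},Q_{Y|X})<\infty$. Then a rate $R$ is robust one-shot achievable if $$R\ge \bar{R}(\theta)+\log\big(|\mathcal{S}|\cdot(\bar{R}(\theta)+1)\big)+4 .$$
   Context: A conditional distribution $Q_{Y|X}$ is a stochastic kernel from $\mathcal{X}$ to $\mathcal{Y}$; for $\mu_X\in\mathcal{M}_1(\mathcal{X})$, $\mu_XQ_{Y|X}$ (or $\mu_X\otimes Q_{Y|X}$) denotes the induced joint law and $I(\mu_X,Q_{Y|X})$ its mutual information; $\bar{I}(\mathcal{S},Q)=\sup_{\mu\in\mathcal{S}}I(\mu,Q)$. The set $\mathcal{L}(\theta)$ consists of all conditional distributions $Q_{Y|X}$ such that $h_i[\mu_XQ_{Y|X}]\le\theta_i$ for all $\mu_X\in\mathcal{S}$ and all $i\in\{1,\ldots,M\}$. The robust information rate function is $\bar{R}(\theta)=\inf_{Q_{Y|X}\in\mathcal{L}(\theta)}\sup_{\mu_X\in\mathcal{S}}I(\mu_X,Q_{Y|X})$. A rate $R$ is robust one-shot achievable if there exist an encoder $f:\mathcal{X}\times\mathcal{Z}\to\mathbb{N}_0$,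 a decoder $g:\mathbb{N}_0\times\mathcal{Z}\to\mathcal{Y}$ and a random variable $Z$ valued in a set $\mathcal{Z}$ (common randomness, independent of the source) such that for every $\mu_X\in\mathcal{S}$, with $X\sim\mu_X$, $M=f(X,Z)$ and $Y=g(M,Z)$, one has $H(M\mid Z)\le R$ and the induced joint distribution $P_{X,Y}$ satisfies $h_i(P_{X,Y})\le\theta_i$ for all $i$. Logarithms and entropies are in bits. *)

theory Defs
  imports "HOL-Probability.Probability"
begin

definition kernels :: "('x::polish_space \<Rightarrow> 'y::polish_space measure) set" where
  "kernels = {Q. Q \<in> borel \<rightarrow>\<^sub>M prob_algebra borel}"

definition joint :: "'x::polish_space measure \<Rightarrow> ('x \<Rightarrow> 'y::polish_space measure) \<Rightarrow> ('x \<times> 'y) measure" where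
  "joint \<mu> Q = \<mu> \<bind> (\<lambda>x. distr (Q x) borel (\<lambda>y. (x, y)))"

text \<open>Relative entropy D(P||Q) in bits, extended-real valued (infinite if P is not
  absolutely continuous w.r.t. Q); the positive and negative parts of the log-density
  are integrated separately (the negative part is always finite).\<close>
definition kl_div :: "'a measure \<Rightarrow> 'a measure \<Rightarrow> ereal" where
  "kl_div P Q =
     (if sets P = sets Q \<and> absolutely_continuous Q P then
        enn2ereal (\<integral>\<^sup>+ x. ennreal (log 2 (enn2real (RN_deriv Q P x))) \<partial>P)
        - enn2ereal (\<integral>\<^sup>+ x. ennreal (- log 2 (enn2real (RN_deriv Q P x))) \<partial>P)
      else \<infinity>)"

definition mutual_inf :: "('x::polish_space \<times> 'y::polish_space) measure \<Rightarrow> ereal" where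
  "mutual_inf P = kl_div P (distr P borel fst \<Otimes>\<^sub>M distr P borel snd)"

definition MI :: "'x::polish_space measure \<Rightarrow> ('x \<Rightarrow> 'y::polish_space measure) \<Rightarrow> ereal" where
  "MI \<mu> Q = mutual_inf (joint \<mu> Q)"

definition Ibar :: "'x::polish_space measure set \<Rightarrow> ('x \<Rightarrow> 'y::polish_space measure) \<Rightarrow> ereal" where
  "Ibar S Q = (SUP \<mu>\<in>S. MI \<mu> Q)"

definition Lset :: "'x::polish_space measure set \<Rightarrow> nat \<Rightarrow> (nat \<Rightarrow> ('x \<times> 'y::polish_space) measure \<Rightarrow> real)
    \<Rightarrow> (nat \<Rightarrow> real) \<Rightarrow> ('x \<Rightarrow> 'y measure) set" where
  "Lset S M h \<theta> = {Q \<in> kernels. \<forall>\<mu>\<in>S. \<forall>i<M. h i (joint \<mu> Q) \<le> \<theta> i}"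

definition Rbar :: "'x::polish_space measure set \<Rightarrow> nat \<Rightarrow> (nat \<Rightarrow> ('x \<times> 'y::polish_space) measure \<Rightarrow> real)
    \<Rightarrow> (nat \<Rightarrow> real) \<Rightarrow> ereal" where
  "Rbar S M h \<theta> = (INF Q\<in>(Lset S M h \<theta> :: ('x \<Rightarrow> 'y measure) set). Ibar S Q)"

definition eta :: "real \<Rightarrow> real" where
  "eta p = - p * log 2 p"

text \<open>H(M | Z) for M = f(X,Z) with X ~ mu independent of Z ~ PZ:
  since X and Z are independent, P(M = m | Z = z) = mu{x. f x z = m}, so
  H(M|Z) = E_Z [ sum_m eta(P(M=m | Z)) ].\<close>
definition cond_entropy_enc :: "'x measure \<Rightarrow> 'z measure \<Rightarrow> ('x \<Rightarrow> 'z \<Rightarrow> nat) \<Rightarrow> ennreal" where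
  "cond_entropy_enc \<mu> PZ f =
     (\<integral>\<^sup>+ z. (\<Sum>m. ennreal (eta (measure \<mu> {x \<in> space \<mu>. f x z = m}))) \<partial>PZ)"

definition code_joint :: "'x::polish_space measure \<Rightarrow> 'z::polish_space measure \<Rightarrow> ('x \<Rightarrow> 'z \<Rightarrow> nat)
    \<Rightarrow> (nat \<Rightarrow> 'z \<Rightarrow> 'y::polish_space) \<Rightarrow> ('x \<times> 'y) measure" where
  "code_joint \<mu> PZ f g = distr (\<mu> \<Otimes>\<^sub>M PZ) borel (\<lambda>(x, z). (x, g (f x z) z))"

text \<open>Robust one-shot achievability. The common randomness Z takes values in the
  Polish space Zsp = R^N (every Polish space embeds Borel-isomorphically into it).\<close>
type_synonym crand = "nat \<Rightarrow> real"

definition robust_achievable :: "'x::polish_space measure set \<Rightarrow> nat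
    \<Rightarrow> (nat \<Rightarrow> ('x \<times> 'y::polish_space) measure \<Rightarrow> real) \<Rightarrow> (nat \<Rightarrow> real) \<Rightarrow> real \<Rightarrow> bool" where
  "robust_achievable S M h \<theta> R \<longleftrightarrow>
     (\<exists>(f :: 'x \<Rightarrow> crand \<Rightarrow> nat) (g :: nat \<Rightarrow> crand \<Rightarrow> 'y) (PZ :: crand measure).
        prob_space PZ \<and> sets PZ = sets borel \<and>
        (\<lambda>(x, z). f x z) \<in> borel \<rightarrow>\<^sub>M count_space UNIV \<and>
        (\<lambda>(m, z). g m z) \<in> count_space UNIV \<Otimes>\<^sub>M borel \<rightarrow>\<^sub>M borel \<and>
        (\<forall>\<mu>\<in>S. enn2ereal (cond_entropy_enc \<mu> PZ f) \<le> ereal R \<and>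
                (\<forall>i<M. h i (code_joint \<mu> PZ f g) \<le> \<theta> i)))"

end

theory Submission
  imports Defs
begin

text \<open>
The code is a greedy rejection sampler with interleaved proposals. Let \<open>P\<^sub>i\<close> be the output marginal of
a near-optimal kernel \<open>Q\<close> under the \<open>i\<close>-th source, let \<open>L\<close> be the sum of the \<open>P\<^sub>i\<close>, and let \<open>r x\<close> be
the density of \<open>Q x\<close> with respect to \<open>L\<close>. The common randomness provides independent proposals; the
\<open>n\<close>-th one has law \<open>P\<^sub>i\<close> for \<open>i = n mod s\<close>, where \<open>s\<close> is the number of sources. The encoder accepts
each proposal with the largest probability for which the mass accepted so far stays below \<open>r x\<close>, and
sends the index \<open>n\<close> of the first accepted proposal, so the output has law exactly \<open>Q x\<close>.

If \<open>\<sigma>\<close> is the probability of reaching step \<open>n\<close>, then at the outputs accepted there the density covered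
so far is some \<open>l < r x\<close> with \<open>n div s \<le> l / \<sigma>\<close>. Since \<open>ln (1 + l / \<sigma>)\<close> is at most a decreasing function
of \<open>\<sigma>\<close> plus an increasing function of \<open>l\<close>, the expected logarithm of the round \<open>n div s + 1\<close>
telescopes, and it is at most the mutual information plus one nat. Coding the round with a
power-law distribution and the residue \<open>n mod s\<close> uniformly bounds the entropy. The constant obtained
is smaller than 4, which absorbs the fact that the infimum in \<^const>\<open>Rbar\<close> need not be attained.
\<close>

section \<open>A convex potential\<close>

text \<open>The functions \<open>h i\<close> are arbitrary, so the constraints pass from
  \<open>Q\<close> to the code only if the joint law of source and output is reproduced exactly;
  approximate simulation would not do. The encoder does not know which source is active, so its rule
  may depend on \<open>x\<close> alone. This is possible because all joint laws share the kernel
  \<open>Q\<close>, which yields one density \<open>r x\<close> valid for every source. Drawing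
  every proposal from the average of the marginals could raise the divergence by log |S|, and this
  term would enter the second logarithm of the bound as well. With interleaving, the densities of
  one round add up to 1 with respect to \<open>L\<close>, so log |S| is paid once, for the residue.
  Measuring against \<open>L\<close> instead of the marginal of the active source costs nothing, by
  convexity of the potential. The extra nat consists of two halves: one from the survival
  probabilities, one from replacing t ln t by the potential. One nat is at most 3/2 bits; with a
  slack of 1/10 for the infimum this gives 8/5. Normalising the power law costs another 7/5 beyond
  log (rate + 1), its exponent costs 1, and the sum is 4.\<close>

definition cvx_potential :: "real \<Rightarrow> real" where
  "cvx_potential t = (if t \<le> 1 then t\<^sup>2 / 2 else t * ln t + 1 / 2)"

text \<open>The derivative of \<open>cvx_potential\<close>, which is its primitive vanishing at 0.
  Unlike t ln t, this primitive is nonnegative and increasing on the nonnegative reals, and it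
  exceeds t ln t by at most 1/2 there.\<close>

definition cvx_slope :: "real \<Rightarrow> real" where
  "cvx_slope t = (if t \<le> 1 then t else 1 + ln t)"

text \<open>Right side minus left side has derivative ln x + 1 - x, which is nonpositive, and
  vanishes at 1. The inequality serves \<open>cvx_potential_le\<close> and, for ratios of survival
  probabilities, \<open>survival_telescope\<close>.\<close>

lemma half_square_le_xlnx:
  fixes t :: real
  assumes "0 \<le> t" "t \<le> 1"
  shows "t\<^sup>2 / 2 \<le> t * ln t + 1 / 2"
proof (cases "t = 0")
  case False
  define h where "h = (\<lambda>t::real. t * ln t + 1 / 2 - t\<^sup>2 / 2)"
  have "h 1 \<le> h t"
  proof (rule DERIV_nonpos_imp_nonincreasing[of t 1 h])
    show "t \<le> 1" by fact
    fix x assume "t \<le> x" "x \<le> 1"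
    then have x: "0 < x" using False assms by linarith
    have "(h has_real_derivative (ln x + 1 - x)) (at x)"
      unfolding h_def using x by (auto intro!: derivative_eq_intros)
    moreover have "ln x + 1 - x \<le> 0" using ln_le_minus_one[OF x] by simp
    ultimately show "\<exists>y. (h has_real_derivative y) (at x) \<and> y \<le> 0" by blast
  qed
  then show ?thesis by (simp add: h_def)
qed simp

lemma cvx_potential_nonneg: "0 \<le> t \<Longrightarrow> 0 \<le> cvx_potential t"
  by (auto simp: cvx_potential_def)

lemma cvx_slope_nonneg: "0 \<le> t \<Longrightarrow> 0 \<le> cvx_slope t"
  by (auto simp: cvx_slope_def)

lemma cvx_potential_0 [simp]: "cvx_potential 0 = 0"
  by (simp add: cvx_potential_def)

lemma cvx_potential_le: "0 \<le> t \<Longrightarrow> cvx_potential t \<le> t * ln t + 1 / 2"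
  using half_square_le_xlnx[of t] by (auto simp: cvx_potential_def)

lemma xlnx_tangent:
  fixes a t :: real
  assumes "0 < a" "0 \<le> t"
  shows "(t - a) * (1 + ln a) \<le> t * ln t - a * ln a"
proof (cases "t = 0")
  case False
  then have t: "0 < t" using assms by simp
  have "ln a - ln t = ln (a / t)" using assms t by (simp add: ln_div)
  also have "\<dots> \<le> a / t - 1" using assms t by (intro ln_le_minus_one) simp
  finally have "t * (ln a - ln t) \<le> a - t" using t by (simp add: field_simps)
  then show ?thesis by (simp add: algebra_simps)
qed (use assms in \<open>simp add: algebra_simps\<close>)

text \<open>Convexity: the tangent at the left end lies below the graph. The right side telescopes
  as the covered density grows, which is its use in \<open>incr_log_le\<close>. For
  \<open>a \<le> 1 < t\<close> the two branches are joined at 1.\<close>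

lemma cvx_potential_subgradient:
  assumes "0 \<le> a" "a \<le> t"
  shows "(t - a) * cvx_slope a \<le> cvx_potential t - cvx_potential a"
proof -
  have sq: "(t - a) * a \<le> t\<^sup>2 / 2 - a\<^sup>2 / 2" for t a :: real
    using zero_le_power2[of "t - a"] by (simp add: power2_eq_square algebra_simps)
  consider "t \<le> 1" | "1 < a" | "a \<le> 1" "1 < t" by linarith
  then show ?thesis
  proof cases
    case 1
    then show ?thesis using sq[of t a] assms by (simp add: cvx_potential_def cvx_slope_def)
  next
    case 2
    then show ?thesis using xlnx_tangent[of a t] assms by (simp add: cvx_potential_def cvx_slope_def)
  next
    case 3
    have "(t - 1) \<le> t * ln t" using xlnx_tangent[of 1 t] 3 by simp
    moreover have "(t - 1) * a \<le> t - 1" using 3 by (simp add: mult_left_le)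
    moreover have "(1 - a) * a \<le> 1 / 2 - a\<^sup>2 / 2" using sq[of 1 a] by simp
    moreover have "(t - a) * a = (t - 1) * a + (1 - a) * a" by (simp add: algebra_simps)
    ultimately have "(t - a) * a \<le> t * ln t + 1 / 2 - a\<^sup>2 / 2" by linarith
    moreover have "cvx_potential t = t * ln t + 1 / 2" "cvx_potential a = a\<^sup>2 / 2" "cvx_slope a = a"
      using 3 by (simp_all add: cvx_potential_def cvx_slope_def)
    ultimately show ?thesis by simp
  qed
qed

lemma cvx_potential_mono: "0 \<le> a \<Longrightarrow> a \<le> t \<Longrightarrow> cvx_potential a \<le> cvx_potential t"
  using cvx_potential_subgradient[of a t] cvx_slope_nonneg[of a]
  by (smt (verit) mult_nonneg_nonneg)

text \<open>Convexity together with the value 0 at 0. In its use, \<open>w\<close> is the density of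
  one output marginal with respect to the sum of all of them, and \<open>t\<close> the density
  against that marginal.\<close>

lemma cvx_potential_scale:
  assumes "0 \<le> w" "w \<le> 1" "0 \<le> t"
  shows "cvx_potential (w * t) \<le> w * cvx_potential t"
proof -
  define a where "a = w * t"
  have a: "0 \<le> a" "a \<le> t" using assms by (auto simp: a_def mult_left_le_one_le)
  \<comment> \<open>The tangent at \<open>a\<close> evaluated at 0. With weight 1 - w, and the
    tangent evaluated at \<open>t\<close> with weight w, the slope terms cancel.\<close>
  have 1: "cvx_potential a \<le> a * cvx_slope a"
    using a by (auto simp: cvx_potential_def cvx_slope_def power2_eq_square algebra_simps)
  have 2: "w * ((t - a) * cvx_slope a) \<le> w * (cvx_potential t - cvx_potential a)"
    using cvx_potential_subgradient[OF a] assms by (intro mult_left_mono) auto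
  have 3: "w * ((t - a) * cvx_slope a) = (1 - w) * (a * cvx_slope a)"
    by (simp add: a_def algebra_simps)
  have "(1 - w) * cvx_potential a \<le> (1 - w) * (a * cvx_slope a)"
    using 1 assms by (intro mult_left_mono) auto
  moreover have "(1 - w) * cvx_potential a = cvx_potential a - w * cvx_potential a"
    "w * (cvx_potential t - cvx_potential a) = w * cvx_potential t - w * cvx_potential a"
    by (simp_all add: algebra_simps)
  ultimately show ?thesis using 2 3 unfolding a_def[symmetric] by linarith
qed

lemma cvx_potential_measurable [measurable]: "cvx_potential \<in> borel_measurable borel"
  unfolding cvx_potential_def[abs_def] by measurable

text \<open>The exact supremum of \<^term>\<open>ln (l + \<sigma>) - \<sigma> + 1\<close> over \<^term>\<open>\<sigma> \<in> {0..1}\<close> is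
  \<^term>\<open>cvx_slope l\<close>; this decouples the two quantities.\<close>

lemma ln_ratio_decouple:
  fixes \<sigma> l :: real
  assumes "0 < \<sigma>" "\<sigma> \<le> 1" "0 \<le> l"
  shows "ln (1 + l / \<sigma>) \<le> (\<sigma> - 1 - ln \<sigma>) + cvx_slope l"
proof -
  have "1 + l / \<sigma> = (\<sigma> + l) / \<sigma>" using assms by (simp add: field_simps)
  then have eq: "ln (1 + l / \<sigma>) = ln (\<sigma> + l) - ln \<sigma>" using assms by (simp add: ln_div)
  have "ln (\<sigma> + l) \<le> \<sigma> - 1 + cvx_slope l"
  proof (cases "l \<le> 1")
    case True
    then show ?thesis using ln_le_minus_one[of "\<sigma> + l"] assms by (simp add: cvx_slope_def)
  next
    case False
    then have "\<sigma> + l = l * (1 + \<sigma> / l)" by (simp add: field_simps)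
    moreover have "0 < 1 + \<sigma> / l" using False assms by (intro add_pos_pos divide_pos_pos) auto
    ultimately have "ln (\<sigma> + l) = ln l + ln (1 + \<sigma> / l)" using False by (simp add: ln_mult)
    also have "ln (1 + \<sigma> / l) \<le> \<sigma> / l" using False assms by (intro ln_add_one_self_le_self) auto
    also have "\<sigma> / l \<le> \<sigma>" using False assms by (simp add: field_simps)
    finally show ?thesis using False by (simp add: cvx_slope_def)
  qed
  then show ?thesis using eq by simp
qed

text \<open>The function a^2/2 - a ln a is concave on (0, 1] with derivative a - 1 - ln a, and this
  is its tangent inequality at \<open>a\<close>. It makes the survival part of the expected
  logarithm telescope.\<close>

lemma survival_telescope:
  fixes a b :: real
  assumes "0 < a" "a \<le> 1" "0 \<le> b" "b \<le> a"
  shows "(a - b) * (a - 1 - ln a) \<le> (a\<^sup>2 / 2 - a * ln a) - (b\<^sup>2 / 2 - b * ln b)"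
proof -
  \<comment> \<open>With b = a t the claim, divided by a, becomes a (1 - t)^2 / 2 \<le> t ln t - t +
    1; for a \<le> 1 this follows from \<open>half_square_le_xlnx\<close>.\<close>
  define t where "t = b / a"
  have t: "0 \<le> t" "t \<le> 1" and b: "b = a * t" using assms by (auto simp: t_def)
  have "(1 - t)\<^sup>2 / 2 \<le> t * ln t - t + 1"
    using half_square_le_xlnx[OF t] by (simp add: power2_eq_square field_simps)
  moreover have "a * ((1 - t)\<^sup>2 / 2) \<le> 1 * ((1 - t)\<^sup>2 / 2)"
    using assms by (intro mult_right_mono) auto
  ultimately have "a * (a * ((1 - t)\<^sup>2 / 2)) \<le> a * (t * ln t - t + 1)"
    using assms by (intro mult_left_mono) auto
  moreover have "b * ln b = a * (t * ln t) + b * ln a"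
    using assms t by (cases "t = 0") (auto simp: b ln_mult algebra_simps)
  ultimately show ?thesis by (simp add: b power2_eq_square field_simps)
qed

lemma survival_potential_nonneg:
  fixes a :: real
  assumes "0 \<le> a" "a \<le> 1"
  shows "0 \<le> a\<^sup>2 / 2 - a * ln a"
proof (cases "a = 0")
  case False
  then have "a * ln a \<le> 0" using assms by (intro mult_nonneg_nonpos) auto
  moreover have "0 \<le> a\<^sup>2 / 2" by simp
  ultimately show ?thesis by linarith
qed simp

section \<open>Greedy rejection sampling\<close>

text \<open>The density accepted in the first \<open>n\<close> steps is \<open>min (r y) (cover L w r n y)\<close>, and \<open>surv L w r n\<close> is the
  probability that all of them reject; proposal \<open>n\<close> has density \<open>w n\<close>.\<close>

primrec cover :: "'y measure \<Rightarrow> (nat \<Rightarrow> 'y \<Rightarrow> real) \<Rightarrow> ('y \<Rightarrow> real) \<Rightarrow> nat \<Rightarrow> 'y \<Rightarrow> real" where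
  "cover L w r 0 = (\<lambda>y. 0)"
| "cover L w r (Suc n) =
     (\<lambda>y. cover L w r n y + (1 - (\<integral>y'. min (r y') (cover L w r n y') \<partial>L)) * w n y)"

definition surv :: "'y measure \<Rightarrow> (nat \<Rightarrow> 'y \<Rightarrow> real) \<Rightarrow> ('y \<Rightarrow> real) \<Rightarrow> nat \<Rightarrow> real" where
  "surv L w r n = 1 - (\<integral>y. min (r y) (cover L w r n y) \<partial>L)"

definition incr :: "'y measure \<Rightarrow> (nat \<Rightarrow> 'y \<Rightarrow> real) \<Rightarrow> ('y \<Rightarrow> real) \<Rightarrow> nat \<Rightarrow> 'y \<Rightarrow> real" where
  "incr L w r n y = min (r y) (cover L w r (Suc n) y) - min (r y) (cover L w r n y)"

text \<open>The acceptance probability is \<open>incr / (surv * w)\<close>; the form without division accepts nothing where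
  the denominator vanishes.\<close>

definition accepts :: "'y measure \<Rightarrow> (nat \<Rightarrow> 'y \<Rightarrow> real) \<Rightarrow> ('y \<Rightarrow> real) \<Rightarrow> nat \<Rightarrow> 'y \<times> real \<Rightarrow> bool" where
  "accepts L w r n yu \<longleftrightarrow> snd yu * (surv L w r n * w n (fst yu)) < incr L w r n (fst yu)"

definition first_accept :: "'y measure \<Rightarrow> (nat \<Rightarrow> 'y \<Rightarrow> real) \<Rightarrow> ('y \<Rightarrow> real) \<Rightarrow> (nat \<Rightarrow> 'y \<times> real) \<Rightarrow> nat" where
  "first_accept L w r \<omega> = (LEAST n. accepts L w r n (\<omega> n))"

definition unit_unif :: "real measure" where
  "unit_unif = uniform_measure lborel {0..1}"

definition proposal :: "'y measure \<Rightarrow> (nat \<Rightarrow> 'y \<Rightarrow> real) \<Rightarrow> nat \<Rightarrow> ('y \<times> real) measure" where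
  "proposal L w n = density L (\<lambda>y. ennreal (w n y)) \<Otimes>\<^sub>M unit_unif"

lemma prob_space_unit_unif: "prob_space unit_unif"
  unfolding unit_unif_def by (rule prob_space_uniform_measure) auto

lemma sets_unit_unif [measurable_cong, simp]: "sets unit_unif = sets borel"
  by (simp add: unit_unif_def)

lemma space_unit_unif [simp]: "space unit_unif = UNIV"
  by (simp add: unit_unif_def)

text \<open>Multiplying by \<open>c\<close> keeps the case \<open>c = 0\<close> true. For
  \<open>0 < c\<close> the set has probability a / c, where \<open>a \<le> c\<close> keeps the
  threshold inside the unit interval.\<close>

lemma scaled_emeasure_unit_unif:
  fixes a c :: real
  assumes "0 \<le> a" "a \<le> c"
  shows "ennreal c * emeasure unit_unif {u. u * c < a} = ennreal a"
proof (cases "c = 0")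
  case False
  then have c: "0 < c" using assms by simp
  have "u \<le> 1" if "u * c < a" for u
    using c assms that mult_right_mono[of 1 u c] by (cases "u \<le> 1") linarith+
  then have "{0..1} \<inter> {u. u * c < a} = {0..<a / c}"
    using c assms by (auto simp: field_simps)
  then have "emeasure unit_unif {u. u * c < a} = ennreal (a / c)"
    using c assms by (simp add: unit_unif_def divide_ennreal_def)
  then show ?thesis using c assms by (simp add: ennreal_mult[symmetric])
qed (use assms in simp)

text \<open>Here \<open>x\<close> is the source symbol. The measurability results are stated for a
  whole family \<open>r\<close>, outside the locale below, because \<open>r x\<close> will be a
  probability density only for almost every \<open>x\<close>, while the encoder has to be measurable
  everywhere.\<close>

lemma cover_measurable:
  assumes L: "sigma_finite_measure L" and [measurable]: "\<And>n. w n \<in> borel_measurable L"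
    and [measurable]: "case_prod r \<in> borel_measurable (X \<Otimes>\<^sub>M L)"
  shows "(\<lambda>(x, y). cover L w (r x) n y) \<in> borel_measurable (X \<Otimes>\<^sub>M L)"
proof -
  interpret sigma_finite_measure L by fact
  show ?thesis
  proof (induction n)
    case (Suc n)
    note [measurable] = Suc
    have "(\<lambda>x. \<integral>y. min (r x y) (cover L w (r x) n y) \<partial>L) \<in> borel_measurable X"
      by (rule borel_measurable_lebesgue_integral) measurable
    note [measurable] = this
    show ?case by simp
  qed simp
qed

lemma surv_measurable:
  assumes "sigma_finite_measure L" and [measurable]: "\<And>n. w n \<in> borel_measurable L"
    and [measurable]: "case_prod r \<in> borel_measurable (X \<Otimes>\<^sub>M L)"
  shows "(\<lambda>x. surv L w (r x) n) \<in> borel_measurable X"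
proof -
  interpret sigma_finite_measure L by fact
  note [measurable] = cover_measurable[OF assms]
  have "(\<lambda>x. \<integral>y. min (r x y) (cover L w (r x) n y) \<partial>L) \<in> borel_measurable X"
    by (rule borel_measurable_lebesgue_integral) measurable
  then show ?thesis unfolding surv_def by measurable
qed

lemma accepts_measurable:
  assumes "sigma_finite_measure L" and [measurable]: "\<And>n. w n \<in> borel_measurable L"
    and [measurable]: "case_prod r \<in> borel_measurable (X \<Otimes>\<^sub>M L)"
  shows "Measurable.pred (X \<Otimes>\<^sub>M (L \<Otimes>\<^sub>M borel)) (\<lambda>(x, yu). accepts L w (r x) n yu)"
proof -
  note [measurable] = cover_measurable[OF assms] surv_measurable[OF assms]
  have [measurable]: "(\<lambda>(x, y). incr L w (r x) n y) \<in> borel_measurable (X \<Otimes>\<^sub>M L)"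
    unfolding incr_def by measurable
  show ?thesis unfolding accepts_def by measurable
qed

lemma first_accept_measurable:
  assumes "sigma_finite_measure L" and "\<And>n. w n \<in> borel_measurable L"
    and "case_prod r \<in> borel_measurable (X \<Otimes>\<^sub>M L)"
  shows "(\<lambda>(x, \<omega>). first_accept L w (r x) \<omega>)
    \<in> X \<Otimes>\<^sub>M (\<Pi>\<^sub>M n\<in>UNIV. L \<Otimes>\<^sub>M borel) \<rightarrow>\<^sub>M count_space UNIV"
proof -
  note [measurable] = accepts_measurable[OF assms]
  have [measurable]: "Measurable.pred (X \<Otimes>\<^sub>M (\<Pi>\<^sub>M n\<in>UNIV. L \<Otimes>\<^sub>M borel))
      (\<lambda>p. accepts L w (r (fst p)) n (snd p n))" for n
  proof -
    have "(\<lambda>p. (fst p, snd p n)) \<in> X \<Otimes>\<^sub>M (\<Pi>\<^sub>M n\<in>UNIV. L \<Otimes>\<^sub>M borel) \<rightarrow>\<^sub>M X \<Otimes>\<^sub>M (L \<Otimes>\<^sub>M borel)"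
      by measurable
    from measurable_compose[OF this accepts_measurable[OF assms]]
    show ?thesis by simp
  qed
  show ?thesis unfolding first_accept_def split_beta by measurable
qed

text \<open>One source symbol is fixed; \<open>r\<close> is its output density with respect to
  \<open>L\<close>, which need not be normalised. \<open>w_sum\<close> is the pointwise effect of
  interleaving: the proposals accumulate at least density 1 per completed round of length
  \<open>s\<close>.\<close>

locale greedy_rejection =
  fixes L :: "'y measure" and w :: "nat \<Rightarrow> 'y \<Rightarrow> real" and r :: "'y \<Rightarrow> real" and s :: nat
  assumes finite_L: "finite_measure L" and space_L: "space L = UNIV"
    and w_measurable [measurable]: "\<And>n. w n \<in> borel_measurable L"
    and w_nonneg: "\<And>n y. 0 \<le> w n y"
    and w_density: "\<And>n. (\<integral>\<^sup>+y. ennreal (w n y) \<partial>L) = 1"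
    and w_sum: "\<And>n y. real (n div s) \<le> (\<Sum>i<n. w i y)"
    and s_pos: "0 < s"
    and r_measurable [measurable]: "r \<in> borel_measurable L"
    and r_nonneg: "\<And>y. 0 \<le> r y"
    and r_density: "(\<integral>\<^sup>+y. ennreal (r y) \<partial>L) = 1"
begin

abbreviation "C \<equiv> cover L w r"
abbreviation "\<sigma> \<equiv> surv L w r"
abbreviation "\<alpha> \<equiv> incr L w r"

lemma cover_borel [measurable]: "C n \<in> borel_measurable L"
  by (induction n) auto

lemma integrable_r: "integrable L r"
  using r_density r_nonneg by (intro integrableI_nonneg) auto

lemma integral_r: "(\<integral>y. r y \<partial>L) = 1"
  using r_density r_nonneg by (simp add: integral_eq_nn_integral)

lemma cover_Suc: "C (Suc n) y = C n y + \<sigma> n * w n y"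
  by (simp add: surv_def)

declare cover.simps(2) [simp del]

text \<open>The two claims feed each other: a nonnegative cover makes the truncated density
  integrable with integral at most 1, and a nonnegative survival probability keeps the next cover
  nonnegative.\<close>

lemma cover_surv_nonneg: "0 \<le> C n y \<and> 0 \<le> \<sigma> n"
proof -
  have *: "0 \<le> \<sigma> n" if "\<And>y. 0 \<le> C n y" for n
  proof -
    have "(\<integral>y. min (r y) (C n y) \<partial>L) \<le> (\<integral>y. r y \<partial>L)"
      using that r_nonneg by (intro Bochner_Integration.integral_mono integrable_r
          Bochner_Integration.integrable_bound[OF integrable_r]) auto
    then show ?thesis by (simp add: surv_def integral_r)
  qed
  have "\<forall>y. 0 \<le> C n y"
    by (induction n) (use * w_nonneg in \<open>auto simp: cover_Suc\<close>)
  then show ?thesis using * by blast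
qed

lemma cover_nonneg: "0 \<le> C n y" and surv_nonneg: "0 \<le> \<sigma> n"
  using cover_surv_nonneg by blast+

lemma integrable_min: "integrable L (\<lambda>y. min (r y) (C n y))"
  using cover_nonneg r_nonneg by (intro Bochner_Integration.integrable_bound[OF integrable_r]) auto

lemma incr_nonneg: "0 \<le> \<alpha> n y"
  using mult_nonneg_nonneg[OF surv_nonneg[of n] w_nonneg[of n y]]
  by (auto simp: incr_def cover_Suc min_def)

text \<open>Hence the acceptance probability never exceeds 1, as
  \<open>scaled_emeasure_unit_unif\<close> requires.\<close>

lemma incr_le: "\<alpha> n y \<le> \<sigma> n * w n y"
  using mult_nonneg_nonneg[OF surv_nonneg[of n] w_nonneg[of n y]]
  by (auto simp: incr_def cover_Suc min_def)

lemma integrable_incr: "integrable L (\<alpha> n)"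
  unfolding incr_def[abs_def] by (intro Bochner_Integration.integrable_diff integrable_min)

lemma incr_borel [measurable]: "\<alpha> n \<in> borel_measurable L"
  using integrable_incr by auto

lemma integral_incr: "(\<integral>y. \<alpha> n y \<partial>L) = \<sigma> n - \<sigma> (Suc n)"
  unfolding incr_def[abs_def] by (simp add: integrable_min surv_def)

lemma surv_Suc_le: "\<sigma> (Suc n) \<le> \<sigma> n"
  using integral_incr[of n] Bochner_Integration.integral_nonneg[of L "\<alpha> n"] incr_nonneg by simp

lemma surv_0 [simp]: "\<sigma> 0 = 1"
  using r_nonneg by (simp add: surv_def min_absorb2)

lemma surv_antimono: "m \<le> n \<Longrightarrow> \<sigma> n \<le> \<sigma> m"
  using lift_Suc_antimono_le[of \<sigma>] surv_Suc_le by blast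

lemma surv_le_1: "\<sigma> n \<le> 1"
  using surv_antimono[of 0 n] by simp

lemma cover_eq_sum: "C n y = (\<Sum>i<n. \<sigma> i * w i y)"
  by (induction n) (auto simp: cover_Suc)

text \<open>Used with \<open>c\<close> the limit of the survival probabilities to show that the
  sampler stops, and with \<open>c = \<sigma> n\<close> to bound the index.\<close>

lemma cover_ge:
  assumes "0 \<le> c" "\<And>i. i < n \<Longrightarrow> c \<le> \<sigma> i"
  shows "c * real (n div s) \<le> C n y"
proof -
  have "c * real (n div s) \<le> c * (\<Sum>i<n. w i y)"
    using w_sum assms by (intro mult_left_mono) auto
  also have "\<dots> \<le> C n y"
    unfolding cover_eq_sum sum_distrib_left
    using assms w_nonneg by (intro sum_mono mult_right_mono) auto
  finally show ?thesis .
qed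

text \<open>If the limit \<open>l\<close> were positive, every round would add at least
  \<open>l\<close> to the cover, so the truncation at \<open>r y\<close> would be reached at every
  point; dominated convergence then forces the limit to be 0.\<close>

lemma surv_tendsto_0: "\<sigma> \<longlonglongrightarrow> 0"
proof -
  have "decseq \<sigma>" by (simp add: decseq_def surv_antimono)
  then obtain l where l: "\<sigma> \<longlonglongrightarrow> l" and l_le: "\<And>n. l \<le> \<sigma> n"
    using surv_nonneg decseq_convergent[of \<sigma> 0] by metis
  have "l \<ge> 0" using l surv_nonneg by (simp add: LIMSEQ_le_const)
  moreover have "\<not> 0 < l"
  proof
    assume "0 < l"
    have "(\<lambda>n. \<integral>y. min (r y) (C n y) \<partial>L) \<longlonglongrightarrow> (\<integral>y. r y \<partial>L)"
    proof (rule integral_dominated_convergence[where w=r])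
      show "AE y in L. (\<lambda>n. min (r y) (C n y)) \<longlonglongrightarrow> r y"
      proof (rule AE_I2, rule tendsto_eventually)
        fix y
        obtain N where N: "r y / l \<le> real N" using real_arch_simple by blast
        have "min (r y) (C n y) = r y" if "n \<ge> N * s" for n
        proof -
          have "N \<le> n div s" using that s_pos by (simp add: less_eq_div_iff_mult_less_eq)
          then have "r y / l \<le> real (n div s)" using N by linarith
          then have "r y \<le> l * real (n div s)" using \<open>0 < l\<close> by (simp add: field_simps)
          also have "\<dots> \<le> C n y" using \<open>0 < l\<close> l_le by (intro cover_ge) auto
          finally show ?thesis by simp
        qed
        then show "\<forall>\<^sub>F n in sequentially. min (r y) (C n y) = r y"
          unfolding eventually_sequentially by blast
      qed
      show "AE y in L. norm (min (r y) (C n y)) \<le> r y" for n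
        using r_nonneg cover_nonneg by auto
    qed (use integrable_r in auto)
    then have "\<sigma> \<longlonglongrightarrow> 1 - 1"
      unfolding surv_def[abs_def] integral_r by (intro tendsto_intros)
    then show False using l LIMSEQ_unique \<open>0 < l\<close> by fastforce
  qed
  ultimately show ?thesis using l by (metis order_le_less)
qed

text \<open>This is why the output law is exact. The partial sums telescope to the truncated
  density, and the error on any \<open>A\<close> is at most the error on the whole space, which is
  \<open>\<sigma> N\<close>.\<close>

lemma incr_sums:
  assumes [measurable]: "A \<in> sets L"
  shows "(\<lambda>n. \<integral>y. indicator A y * \<alpha> n y \<partial>L) sums (\<integral>y. indicator A y * r y \<partial>L)"
proof -
  have int: "integrable L (\<lambda>y. indicator A y * f y)" if "integrable L f" for f :: "'y \<Rightarrow> real"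
    using integrable_real_mult_indicator[OF assms that] by (simp add: mult.commute)
  have i1: "integrable L (\<lambda>y. indicator A y * min (r y) (C n y))" for n
    using integrable_min by (rule int)
  have i2: "integrable L (\<lambda>y. indicator A y * r y)"
    using integrable_r by (rule int)
  have part: "(\<Sum>n<N. \<integral>y. indicator A y * \<alpha> n y \<partial>L) = (\<integral>y. indicator A y * min (r y) (C N y) \<partial>L)" for N
  proof (induction N)
    case (Suc N)
    have "(\<integral>y. indicator A y * \<alpha> N y \<partial>L) =
        (\<integral>y. indicator A y * min (r y) (C (Suc N) y) - indicator A y * min (r y) (C N y) \<partial>L)"
      by (simp add: incr_def right_diff_distrib)
    also have "\<dots> = (\<integral>y. indicator A y * min (r y) (C (Suc N) y) \<partial>L)
        - (\<integral>y. indicator A y * min (r y) (C N y) \<partial>L)"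
      using i1 by (rule Bochner_Integration.integral_diff) (rule i1)
    finally show ?case using Suc by simp
  qed (use r_nonneg in \<open>simp add: min_absorb2\<close>)
  have "norm ((\<integral>y. indicator A y * min (r y) (C N y) \<partial>L) - (\<integral>y. indicator A y * r y \<partial>L)) \<le> \<sigma> N" for N
  proof -
    have "0 \<le> (\<integral>y. indicator A y * r y \<partial>L) - (\<integral>y. indicator A y * min (r y) (C N y) \<partial>L)"
      using i1 i2 by (auto intro!: Bochner_Integration.integral_mono simp: indicator_def)
    moreover have "(\<integral>y. indicator A y * r y \<partial>L) - (\<integral>y. indicator A y * min (r y) (C N y) \<partial>L)
        = (\<integral>y. indicator A y * r y - indicator A y * min (r y) (C N y) \<partial>L)"
      using i1 i2 by simp
    moreover have "\<dots> \<le> (\<integral>y. r y - min (r y) (C N y) \<partial>L)"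
      using i1 i2 integrable_r integrable_min
      by (intro Bochner_Integration.integral_mono Bochner_Integration.integrable_diff)
         (auto simp: indicator_def)
    moreover have "\<dots> = \<sigma> N"
      using integrable_r integrable_min by (simp add: surv_def integral_r)
    ultimately show ?thesis by simp
  qed
  then have "(\<lambda>N. (\<integral>y. indicator A y * min (r y) (C N y) \<partial>L) - (\<integral>y. indicator A y * r y \<partial>L)) \<longlonglongrightarrow> 0"
    by (intro Lim_null_comparison[OF _ surv_tendsto_0]) auto
  then show ?thesis unfolding sums_def part by (simp add: LIM_zero_iff)
qed

lemma incr_log_le:
  "\<alpha> n y * ln (real (n div s + 1)) \<le> \<alpha> n y * (\<sigma> n - 1 - ln (\<sigma> n))
     + (cvx_potential (min (r y) (C (Suc n) y)) - cvx_potential (min (r y) (C n y)))"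
proof (cases "\<alpha> n y = 0")
  case True
  then have "min (r y) (C (Suc n) y) = min (r y) (C n y)" by (simp add: incr_def)
  then show ?thesis using True by simp
next
  case False
  then have \<alpha>: "0 < \<alpha> n y" using incr_nonneg[of n y] by simp
  then have "0 < \<sigma> n * w n y" using incr_le[of n y] by linarith
  then have \<sigma>: "0 < \<sigma> n" using surv_nonneg[of n] by (metis less_eq_real_def mult_zero_left)
  \<comment> \<open>A positive increment means that \<open>y\<close> is not saturated yet, so the
    truncation is inactive at step \<open>n\<close> and the tangent of the potential can be taken at
    \<open>C n y\<close> itself.\<close>
  have cr: "C n y < r y" using \<alpha> w_nonneg[of n y] surv_nonneg[of n]
    by (auto simp: incr_def cover_Suc min_def split: if_splits)
  \<comment> \<open>All earlier survival probabilities are at least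
    \<open>\<sigma> n\<close>.\<close>
  have "\<sigma> n * real (n div s) \<le> C n y"
    using surv_nonneg by (intro cover_ge surv_antimono) auto
  then have "real (n div s + 1) \<le> 1 + C n y / \<sigma> n"
    using \<sigma> by (simp add: field_simps)
  then have "ln (real (n div s + 1)) \<le> ln (1 + C n y / \<sigma> n)" by simp
  also have "\<dots> \<le> (\<sigma> n - 1 - ln (\<sigma> n)) + cvx_slope (C n y)"
    using \<sigma> surv_le_1 cover_nonneg by (intro ln_ratio_decouple) auto
  finally have "\<alpha> n y * ln (real (n div s + 1)) \<le> \<alpha> n y * ((\<sigma> n - 1 - ln (\<sigma> n)) + cvx_slope (C n y))"
    using \<alpha> by (intro mult_left_mono) auto
  moreover have "\<alpha> n y * cvx_slope (C n y)
      \<le> cvx_potential (min (r y) (C (Suc n) y)) - cvx_potential (min (r y) (C n y))"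
    using cvx_potential_subgradient[of "C n y" "min (r y) (C (Suc n) y)"] cr cover_nonneg[of n y] \<alpha>
    by (simp add: incr_def)
  ultimately show ?thesis by (simp add: algebra_simps)
qed

text \<open>The factor \<open>\<sigma> n - \<sigma> (Suc n)\<close> is the probability that index
  \<open>n\<close> is sent, see \<open>emeasure_first_accept_eq\<close>. After integrating
  \<open>incr_log_le\<close> over \<open>y\<close>, both parts telescope; 1/2 is the value of a^2/2
  - a ln a at the initial survival probability 1.\<close>

lemma expected_log_le:
  "(\<Sum>n. ennreal (ln (real (n div s + 1)) * (\<sigma> n - \<sigma> (Suc n))))
     \<le> ennreal (1 / 2) + (\<integral>\<^sup>+y. ennreal (cvx_potential (r y)) \<partial>L)"
proof (rule suminf_le_const)
  fix N
  define \<phi> where "\<phi> a = a\<^sup>2 / 2 - a * ln a" for a :: real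
  define \<psi> where "\<psi> a = a - 1 - ln a" for a :: real
  have psi: "(\<sigma> n - \<sigma> (Suc n)) * \<psi> (\<sigma> n) \<le> \<phi> (\<sigma> n) - \<phi> (\<sigma> (Suc n))" for n
  proof (cases "\<sigma> n = 0")
    case True
    then show ?thesis using surv_nonneg[of "Suc n"] surv_Suc_le[of n] by simp
  next
    case False
    then show ?thesis unfolding \<phi>_def \<psi>_def
      using surv_nonneg surv_Suc_le surv_le_1 by (intro survival_telescope) (auto simp: less_le)
  qed
  have tel: "(\<Sum>n<N. (\<sigma> n - \<sigma> (Suc n)) * \<psi> (\<sigma> n)) \<le> 1 / 2"
  proof -
    have "(\<Sum>n<N. (\<sigma> n - \<sigma> (Suc n)) * \<psi> (\<sigma> n)) \<le> (\<Sum>n<N. \<phi> (\<sigma> n) - \<phi> (\<sigma> (Suc n)))"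
      by (intro sum_mono psi)
    also have "\<dots> = \<phi> 1 - \<phi> (\<sigma> N)" using sum_lessThan_telescope'[of "\<lambda>n. \<phi> (\<sigma> n)" N] by simp
    also have "\<dots> \<le> 1 / 2"
      using survival_potential_nonneg[OF surv_nonneg surv_le_1] by (simp add: \<phi>_def)
    finally show ?thesis .
  qed
  \<comment> \<open>Allows the passage to \<open>ennreal\<close> without truncation. At survival
    probability 0 the value of \<open>\<psi>\<close> carries no meaning, but nothing is accepted
    there.\<close>
  have psi_nonneg: "0 \<le> \<alpha> n y * \<psi> (\<sigma> n)" for n y
  proof (cases "\<sigma> n = 0")
    case True
    then show ?thesis using incr_nonneg[of n y] incr_le[of n y] by simp
  next
    case False
    then have "0 \<le> \<psi> (\<sigma> n)" using ln_le_minus_one[of "\<sigma> n"] surv_nonneg[of n] by (simp add: \<psi>_def)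
    then show ?thesis using incr_nonneg by simp
  qed
  have ln_nonneg: "0 \<le> ln (real (n div s + 1))" for n by simp
  have pt: "(\<Sum>n<N. \<alpha> n y * ln (real (n div s + 1))) \<le> (\<Sum>n<N. \<alpha> n y * \<psi> (\<sigma> n)) + cvx_potential (r y)" for y
  proof -
    have "(\<Sum>n<N. \<alpha> n y * ln (real (n div s + 1))) \<le> (\<Sum>n<N. \<alpha> n y * \<psi> (\<sigma> n)
       + (cvx_potential (min (r y) (C (Suc n) y)) - cvx_potential (min (r y) (C n y))))"
      unfolding \<psi>_def by (intro sum_mono incr_log_le)
    also have "\<dots> = (\<Sum>n<N. \<alpha> n y * \<psi> (\<sigma> n)) + (cvx_potential (min (r y) (C N y)) - cvx_potential (min (r y) (C 0 y)))"
      unfolding sum.distrib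
      using sum_lessThan_telescope[of "\<lambda>n. cvx_potential (min (r y) (C n y))" N] by simp
    also have "\<dots> \<le> (\<Sum>n<N. \<alpha> n y * \<psi> (\<sigma> n)) + cvx_potential (r y)"
      using cvx_potential_mono[of "min (r y) (C N y)" "r y"] r_nonneg[of y] cover_nonneg[of N y]
      by (simp add: min_absorb2)
    finally show ?thesis .
  qed
  have "(\<Sum>n<N. ennreal (ln (real (n div s + 1)) * (\<sigma> n - \<sigma> (Suc n))))
      = ennreal (\<Sum>n<N. ln (real (n div s + 1)) * (\<sigma> n - \<sigma> (Suc n)))"
    using surv_Suc_le by (intro sum_ennreal mult_nonneg_nonneg ln_nonneg) auto
  also have "(\<Sum>n<N. ln (real (n div s + 1)) * (\<sigma> n - \<sigma> (Suc n)))
      = (\<integral>y. (\<Sum>n<N. \<alpha> n y * ln (real (n div s + 1))) \<partial>L)"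
    using integrable_incr by (simp add: integral_incr mult.commute)
  also have "ennreal \<dots> = (\<integral>\<^sup>+y. ennreal (\<Sum>n<N. \<alpha> n y * ln (real (n div s + 1))) \<partial>L)"
    using integrable_incr incr_nonneg
    by (intro nn_integral_eq_integral[symmetric]) (auto intro!: sum_nonneg mult_nonneg_nonneg)
  also have "\<dots> \<le> (\<integral>\<^sup>+y. ennreal (\<Sum>n<N. \<alpha> n y * \<psi> (\<sigma> n)) + ennreal (cvx_potential (r y)) \<partial>L)"
    using pt psi_nonneg r_nonneg cvx_potential_nonneg
    by (intro nn_integral_mono) (auto simp: sum_nonneg ennreal_leI simp flip: ennreal_plus)
  also have "\<dots> = (\<integral>\<^sup>+y. ennreal (\<Sum>n<N. \<alpha> n y * \<psi> (\<sigma> n)) \<partial>L) + (\<integral>\<^sup>+y. ennreal (cvx_potential (r y)) \<partial>L)"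
    by (rule nn_integral_add) measurable
  also have "(\<integral>\<^sup>+y. ennreal (\<Sum>n<N. \<alpha> n y * \<psi> (\<sigma> n)) \<partial>L) = ennreal (\<integral>y. (\<Sum>n<N. \<alpha> n y * \<psi> (\<sigma> n)) \<partial>L)"
    using integrable_incr psi_nonneg by (intro nn_integral_eq_integral) (auto intro!: sum_nonneg)
  also have "(\<integral>y. (\<Sum>n<N. \<alpha> n y * \<psi> (\<sigma> n)) \<partial>L) = (\<Sum>n<N. (\<sigma> n - \<sigma> (Suc n)) * \<psi> (\<sigma> n))"
    using integrable_incr by (simp add: integral_incr)
  also have "ennreal \<dots> \<le> ennreal (1 / 2)" using tel by (rule ennreal_leI)
  finally show "(\<Sum>n<N. ennreal (ln (real (n div s + 1)) * (\<sigma> n - \<sigma> (Suc n))))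
     \<le> ennreal (1 / 2) + (\<integral>\<^sup>+y. ennreal (cvx_potential (r y)) \<partial>L)"
    by (simp add: add_right_mono)
qed simp

section \<open>Probabilities of acceptance, selected index and output law\<close>

lemma prob_space_reference: "prob_space (density L (\<lambda>y. ennreal (w n y)))"
proof (rule prob_spaceI)
  have "emeasure (density L (\<lambda>y. ennreal (w n y))) (space L) = 1"
    by (subst emeasure_density) (simp_all add: w_density cong: nn_integral_cong)
  then show "emeasure (density L (\<lambda>y. ennreal (w n y))) (space (density L (\<lambda>y. ennreal (w n y)))) = 1"
    by simp
qed

lemma prob_space_proposal: "prob_space (proposal L w n)"
  unfolding proposal_def by (intro prob_space_pair prob_space_reference prob_space_unit_unif)

lemma sets_proposal [measurable_cong]: "sets (proposal L w n) = sets (L \<Otimes>\<^sub>M borel)"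
  unfolding proposal_def by (intro sets_pair_measure_cong) auto

lemma space_proposal [simp]: "space (proposal L w n) = UNIV"
  unfolding proposal_def by (simp add: space_pair_measure space_L)

lemma accepts_pred [measurable]: "Measurable.pred (L \<Otimes>\<^sub>M borel) (accepts L w r n)"
  unfolding accepts_def[abs_def] by measurable

text \<open>Given the proposed \<open>y\<close>, the uniform variable accepts with probability incr
  / (surv * w), and integrating against the proposal density cancels \<open>w\<close>. The factor
  \<open>\<sigma> n\<close> stays on the left so that the formula also holds at
  \<open>\<sigma> n = 0\<close>.\<close>

lemma emeasure_accepts:
  assumes [measurable]: "A \<in> sets L"
  shows "ennreal (\<sigma> n) * emeasure (proposal L w n) {p. accepts L w r n p \<and> fst p \<in> A}
    = ennreal (\<integral>y. indicator A y * \<alpha> n y \<partial>L)"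
proof -
  interpret U: prob_space unit_unif by (rule prob_space_unit_unif)
  let ?E = "{p. accepts L w r n p \<and> fst p \<in> A}"
  have E [measurable]: "?E \<in> sets (proposal L w n)"
  proof -
    have "{p \<in> space (L \<Otimes>\<^sub>M borel). accepts L w r n p \<and> fst p \<in> A} \<in> sets (L \<Otimes>\<^sub>M borel)"
      by measurable
    then show ?thesis by (simp add: sets_proposal space_pair_measure space_L)
  qed
  have "emeasure (proposal L w n) ?E = (\<integral>\<^sup>+y. emeasure unit_unif (Pair y -` ?E) \<partial>density L (\<lambda>y. ennreal (w n y)))"
    using E unfolding proposal_def by (rule U.emeasure_pair_measure_alt)
  also have "\<dots> = (\<integral>\<^sup>+y. ennreal (w n y) * emeasure unit_unif (Pair y -` ?E) \<partial>L)"
    using U.measurable_emeasure_Pair[OF E[unfolded proposal_def]] by (intro nn_integral_density) auto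
  finally have "ennreal (\<sigma> n) * emeasure (proposal L w n) ?E
      = (\<integral>\<^sup>+y. ennreal (\<sigma> n) * (ennreal (w n y) * emeasure unit_unif (Pair y -` ?E)) \<partial>L)"
    using U.measurable_emeasure_Pair[OF E[unfolded proposal_def]] by (subst nn_integral_cmult) auto
  also have "\<dots> = (\<integral>\<^sup>+y. ennreal (indicator A y * \<alpha> n y) \<partial>L)"
  proof (rule nn_integral_cong)
    fix y
    show "ennreal (\<sigma> n) * (ennreal (w n y) * emeasure unit_unif (Pair y -` ?E)) = ennreal (indicator A y * \<alpha> n y)"
    proof (cases "y \<in> A")
      case True
      then have "Pair y -` ?E = {u. u * (\<sigma> n * w n y) < \<alpha> n y}"
        by (auto simp: accepts_def)
      then show ?thesis
        using scaled_emeasure_unit_unif[OF incr_nonneg incr_le, of n y] True surv_nonneg w_nonneg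
        by (simp add: ennreal_mult mult.assoc)
    qed simp
  qed
  also have "\<dots> = ennreal (\<integral>y. indicator A y * \<alpha> n y \<partial>L)"
    using integrable_real_mult_indicator[OF assms integrable_incr] incr_nonneg
    by (intro nn_integral_eq_integral) (auto simp: mult.commute)
  finally show ?thesis .
qed

lemma accepts_sets [measurable]: "{p. accepts L w r n p} \<in> sets (proposal L w n)"
proof -
  have "{p \<in> space (L \<Otimes>\<^sub>M borel). accepts L w r n p} \<in> sets (L \<Otimes>\<^sub>M borel)" by measurable
  then show ?thesis by (simp add: sets_proposal space_pair_measure space_L)
qed

text \<open>Identifies \<open>surv\<close> as a probability: multiplied over the steps, the
  rejection probabilities give \<open>\<sigma> n\<close>.\<close>

lemma emeasure_rejects:
  "ennreal (\<sigma> n) * emeasure (proposal L w n) {p. \<not> accepts L w r n p} = ennreal (\<sigma> (Suc n))"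
proof -
  interpret P: prob_space "proposal L w n" by (rule prob_space_proposal)
  have "ennreal (\<sigma> n) * emeasure (proposal L w n) {p. accepts L w r n p \<and> fst p \<in> UNIV} = ennreal (\<sigma> n - \<sigma> (Suc n))"
    using sets.top[of L] by (subst emeasure_accepts) (auto simp: space_L integral_incr)
  then have "\<sigma> n * P.prob {p. accepts L w r n p} = \<sigma> n - \<sigma> (Suc n)"
    using surv_nonneg[of n] surv_Suc_le[of n]
    by (simp add: P.emeasure_eq_measure ennreal_mult[symmetric])
  moreover have "P.prob {p. \<not> accepts L w r n p} = 1 - P.prob {p. accepts L w r n p}"
    using P.prob_compl[OF accepts_sets] by (simp add: Collect_neg_eq Compl_eq_Diff_UNIV)
  ultimately have "\<sigma> n * P.prob {p. \<not> accepts L w r n p} = \<sigma> (Suc n)"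
    by (simp add: right_diff_distrib)
  then show ?thesis using surv_nonneg[of n]
    by (simp add: P.emeasure_eq_measure ennreal_mult[symmetric])
qed

abbreviation "\<Omega> \<equiv> \<Pi>\<^sub>M n\<in>UNIV. proposal L w n"

lemma prob_space_runs: "prob_space \<Omega>"
  by (intro prob_space_PiM prob_space_proposal)

text \<open>The event is a cylinder over the independent proposals 0 to \<open>n\<close>, so its
  probability is a product.\<close>

lemma emeasure_rejected_until:
  assumes E: "E \<in> sets (proposal L w n)"
  shows "emeasure \<Omega> {\<omega>. (\<forall>i<n. \<not> accepts L w r i (\<omega> i)) \<and> \<omega> n \<in> E} = ennreal (\<sigma> n) * emeasure (proposal L w n) E"
proof -
  define X where "X i = (if i < n then {p. \<not> accepts L w r i p} else E)" for i
  have X: "X i \<in> sets (proposal L w i)" if "i \<le> n" for i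
    using that E sets.compl_sets[OF accepts_sets, of i]
    by (cases "i = n") (auto simp: X_def Collect_neg_eq Compl_eq_Diff_UNIV)
  have "{\<omega>. (\<forall>i<n. \<not> accepts L w r i (\<omega> i)) \<and> \<omega> n \<in> E} = prod_emb UNIV (proposal L w) {..n} (Pi\<^sub>E {..n} X)"
    by (auto simp: prod_emb_def X_def PiE_iff space_PiM split: if_splits)
  then have "emeasure \<Omega> {\<omega>. (\<forall>i<n. \<not> accepts L w r i (\<omega> i)) \<and> \<omega> n \<in> E}
      = (\<Prod>i\<in>{..n}. emeasure (proposal L w i) (X i))"
    by (simp only:) (intro emeasure_PiM_emb prob_space_proposal, use X in auto)
  also have "\<dots> = (\<Prod>i<n. emeasure (proposal L w i) {p. \<not> accepts L w r i p}) * emeasure (proposal L w n) E"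
    by (simp add: X_def flip: lessThan_Suc_atMost)
  also have "(\<Prod>i<n. emeasure (proposal L w i) {p. \<not> accepts L w r i p}) = ennreal (\<sigma> n)"
    using emeasure_rejects by (induction n) simp_all
  finally show ?thesis .
qed

lemma accepts_component [measurable]: "Measurable.pred \<Omega> (\<lambda>\<omega>. accepts L w r n (\<omega> n))"
proof -
  have "(\<lambda>\<omega>. \<omega> n) \<in> \<Omega> \<rightarrow>\<^sub>M L \<Otimes>\<^sub>M borel"
    by (rule measurable_compose[OF measurable_component_singleton[OF UNIV_I]])
       (simp add: measurable_ident_sets sets_proposal)
  then show ?thesis by (rule measurable_compose[OF _ accepts_pred])
qed

lemma fst_component [measurable]: "(\<lambda>\<omega>. fst (\<omega> n)) \<in> \<Omega> \<rightarrow>\<^sub>M L"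
proof -
  have "(\<lambda>\<omega>. \<omega> n) \<in> \<Omega> \<rightarrow>\<^sub>M L \<Otimes>\<^sub>M borel"
    by (rule measurable_compose[OF measurable_component_singleton[OF UNIV_I]])
       (simp add: measurable_ident_sets sets_proposal)
  then show ?thesis by (rule measurable_compose) measurable
qed

lemma first_accept_component [measurable]: "first_accept L w r \<in> \<Omega> \<rightarrow>\<^sub>M count_space UNIV"
  unfolding first_accept_def[abs_def] by measurable

lemma space_runs [simp]: "space \<Omega> = UNIV"
  by (simp add: space_PiM)

text \<open>The exceptional event has probability at most \<open>\<sigma> n\<close> for every
  \<open>n\<close>. It has to be null because \<open>LEAST\<close> in \<open>first_accept\<close>
  says nothing about a run without acceptance.\<close>

lemma AE_accepts: "AE \<omega> in \<Omega>. \<exists>n. accepts L w r n (\<omega> n)"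
proof -
  let ?N = "{\<omega> \<in> space \<Omega>. \<not> (\<exists>n. accepts L w r n (\<omega> n))}"
  have N: "?N \<in> sets \<Omega>" by measurable
  have "emeasure \<Omega> ?N \<le> ennreal (\<sigma> n)" for n
  proof -
    interpret P: prob_space "proposal L w n" by (rule prob_space_proposal)
    let ?M = "{\<omega>. (\<forall>i<n. \<not> accepts L w r i (\<omega> i)) \<and> \<omega> n \<in> space (proposal L w n)}"
    have "{\<omega> \<in> space \<Omega>. \<forall>i<n. \<not> accepts L w r i (\<omega> i)} \<in> sets \<Omega>" by measurable
    then have "emeasure \<Omega> ?N \<le> emeasure \<Omega> ?M" by (intro emeasure_mono) auto
    also have "\<dots> = ennreal (\<sigma> n)"
      by (subst emeasure_rejected_until[OF sets.top]) (simp add: P.emeasure_space_1[simplified])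
    finally show ?thesis .
  qed
  then have "emeasure \<Omega> ?N \<le> 0"
    using tendsto_ennrealI[OF surv_tendsto_0] by (intro LIMSEQ_le_const[of "\<lambda>n. ennreal (\<sigma> n)"]) auto
  then show ?thesis using N by (intro AE_I[where N="?N"]) auto
qed

lemma emeasure_first_accept:
  assumes [measurable]: "A \<in> sets L"
  shows "emeasure \<Omega> {\<omega>. first_accept L w r \<omega> = n \<and> fst (\<omega> n) \<in> A} = ennreal (\<integral>y. indicator A y * \<alpha> n y \<partial>L)"
proof -
  let ?E = "{p. accepts L w r n p \<and> fst p \<in> A}"
  have "{p \<in> space (L \<Otimes>\<^sub>M borel). accepts L w r n p \<and> fst p \<in> A} \<in> sets (L \<Otimes>\<^sub>M borel)"
    by measurable
  then have E: "?E \<in> sets (proposal L w n)" by (simp add: sets_proposal space_pair_measure space_L)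
  have "first_accept L w r \<omega> = n \<longleftrightarrow> (\<forall>i<n. \<not> accepts L w r i (\<omega> i)) \<and> accepts L w r n (\<omega> n)"
    if "\<exists>n. accepts L w r n (\<omega> n)" for \<omega>
  proof
    assume "first_accept L w r \<omega> = n"
    then show "(\<forall>i<n. \<not> accepts L w r i (\<omega> i)) \<and> accepts L w r n (\<omega> n)"
      using LeastI_ex[OF that] not_less_Least unfolding first_accept_def by blast
  next
    assume "(\<forall>i<n. \<not> accepts L w r i (\<omega> i)) \<and> accepts L w r n (\<omega> n)"
    then show "first_accept L w r \<omega> = n"
      unfolding first_accept_def by (intro Least_equality) (auto simp: not_less[symmetric])
  qed
  then have "AE \<omega> in \<Omega>. \<omega> \<in> {\<omega>. first_accept L w r \<omega> = n \<and> fst (\<omega> n) \<in> A} \<longleftrightarrow>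
      \<omega> \<in> {\<omega>. (\<forall>i<n. \<not> accepts L w r i (\<omega> i)) \<and> \<omega> n \<in> ?E}"
    using AE_accepts by (auto elim!: eventually_mono)
  moreover have "{\<omega> \<in> space \<Omega>. first_accept L w r \<omega> = n \<and> fst (\<omega> n) \<in> A} \<in> sets \<Omega>"
    by measurable
  moreover have "{\<omega> \<in> space \<Omega>. (\<forall>i<n. \<not> accepts L w r i (\<omega> i)) \<and> (accepts L w r n (\<omega> n) \<and> fst (\<omega> n) \<in> A)} \<in> sets \<Omega>"
    by measurable
  ultimately have "emeasure \<Omega> {\<omega>. first_accept L w r \<omega> = n \<and> fst (\<omega> n) \<in> A}
      = emeasure \<Omega> {\<omega>. (\<forall>i<n. \<not> accepts L w r i (\<omega> i)) \<and> \<omega> n \<in> ?E}"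
    by (intro emeasure_eq_AE) simp_all
  also have "\<dots> = ennreal (\<integral>y. indicator A y * \<alpha> n y \<partial>L)"
    unfolding emeasure_rejected_until[OF E] emeasure_accepts[OF assms] ..
  finally show ?thesis .
qed

lemma emeasure_first_accept_eq: "emeasure \<Omega> {\<omega>. first_accept L w r \<omega> = n} = ennreal (\<sigma> n - \<sigma> (Suc n))"
  using emeasure_first_accept[OF sets.top, of n] by (simp add: space_L integral_incr)

lemma emeasure_selected:
  assumes [measurable]: "A \<in> sets L"
  shows "emeasure \<Omega> {\<omega>. fst (\<omega> (first_accept L w r \<omega>)) \<in> A} = (\<integral>\<^sup>+y. ennreal (r y) * indicator A y \<partial>L)"
proof -
  let ?D = "\<lambda>n. {\<omega>. first_accept L w r \<omega> = n \<and> fst (\<omega> n) \<in> A}"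
  have "{\<omega> \<in> space \<Omega>. first_accept L w r \<omega> = n \<and> fst (\<omega> n) \<in> A} \<in> sets \<Omega>" for n
    by measurable
  then have D: "range ?D \<subseteq> sets \<Omega>" by auto
  have "{\<omega>. fst (\<omega> (first_accept L w r \<omega>)) \<in> A} = (\<Union>n. ?D n)" by auto
  then have "emeasure \<Omega> {\<omega>. fst (\<omega> (first_accept L w r \<omega>)) \<in> A} = (\<Sum>n. emeasure \<Omega> (?D n))"
    using suminf_emeasure[OF D] by (simp add: disjoint_family_on_def disjoint_iff)
  also have "\<dots> = (\<Sum>n. ennreal (\<integral>y. indicator A y * \<alpha> n y \<partial>L))"
    by (simp add: emeasure_first_accept)
  also have "\<dots> = ennreal (\<integral>y. indicator A y * r y \<partial>L)"
    using incr_nonneg by (intro suminf_ennreal_eq incr_sums assms) (auto intro!: Bochner_Integration.integral_nonneg)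
  also have "\<dots> = (\<integral>\<^sup>+y. ennreal (indicator A y * r y) \<partial>L)"
    using integrable_real_mult_indicator[OF assms integrable_r] r_nonneg
    by (intro nn_integral_eq_integral[symmetric]) (auto simp: mult.commute)
  also have "\<dots> = (\<integral>\<^sup>+y. ennreal (r y) * indicator A y \<partial>L)"
    by (intro nn_integral_cong) (auto simp: indicator_def)
  finally show ?thesis .
qed

end

section \<open>Entropy of the selected index\<close>

lemma eta_nonneg: "0 \<le> p \<Longrightarrow> p \<le> 1 \<Longrightarrow> 0 \<le> eta p"
proof -
  assume "0 \<le> p" "p \<le> 1"
  then have "p * log 2 p \<le> 0" by (cases "p = 0") (auto intro!: mult_nonneg_nonpos)
  then show ?thesis by (simp add: eta_def)
qed

text \<open>The Gibbs inequality for a single term, from ln x \<le> x - 1 at x = q / p. The linear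
  terms are kept on both sides so that, for \<open>p\<close> and \<open>q\<close> at most 1, all
  terms are nonnegative and can be summed in \<open>ennreal\<close>; after summation they are
  cancelled.\<close>

lemma eta_le_cross:
  assumes "0 \<le> p" "0 < q"
  shows "eta p + p / ln 2 \<le> p * (- log 2 q) + q / ln 2"
proof (cases "p = 0")
  case False
  then have p: "0 < p" using assms by simp
  have "ln q - ln p \<le> q / p - 1"
    using ln_le_minus_one[of "q / p"] p assms by (simp add: ln_div)
  then have "p * (ln q - ln p) \<le> q - p" using p by (simp add: field_simps)
  then have "p * (ln q - ln p) / ln 2 \<le> (q - p) / ln 2" by (intro divide_right_mono) auto
  then show ?thesis by (simp add: eta_def log_def field_simps)
qed (use assms in \<open>simp add: eta_def\<close>)

text \<open>For each \<open>z\<close> the entropy is at most the cross-entropy against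
  \<open>q\<close>. As \<open>q\<close> does not depend on \<open>z\<close>, this bound is linear in
  the conditional law, and averaging over \<open>z\<close> leaves only the overall law of the
  index.\<close>

lemma cond_entropy_enc_le_cross:
  fixes f :: "'x \<Rightarrow> 'z \<Rightarrow> nat"
  assumes \<mu>: "prob_space \<mu>" and PZ: "prob_space PZ"
    and f: "(\<lambda>(x, z). f x z) \<in> \<mu> \<Otimes>\<^sub>M PZ \<rightarrow>\<^sub>M count_space UNIV"
    and q: "\<And>m. 0 < q m" "(\<Sum>m. ennreal (q m)) \<le> 1"
  shows "cond_entropy_enc \<mu> PZ f
    \<le> (\<Sum>m. ennreal (- log 2 (q m)) * emeasure (\<mu> \<Otimes>\<^sub>M PZ) {p \<in> space (\<mu> \<Otimes>\<^sub>M PZ). f (fst p) (snd p) = m})"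
proof -
  interpret X: prob_space \<mu> by fact
  interpret Z: prob_space PZ by fact
  interpret pair_sigma_finite \<mu> PZ ..
  let ?F = "\<lambda>m. {p \<in> space (\<mu> \<Otimes>\<^sub>M PZ). f (fst p) (snd p) = m}"
  have F: "?F m \<in> sets (\<mu> \<Otimes>\<^sub>M PZ)" for m
    using measurable_sets[OF f, of "{m}"] by (simp add: vimage_def Int_def split_beta conj_commute)
  have Fz: "(\<lambda>x. (x, z)) -` ?F m = {x \<in> space \<mu>. f x z = m}" if "z \<in> space PZ" for m z
    using that by (auto simp: space_pair_measure)
  have Fz_sets: "{x \<in> space \<mu>. f x z = m} \<in> sets \<mu>" if "z \<in> space PZ" for m z
    using sets_Pair2[OF F, of z m] Fz[OF that] by simp
  \<comment> \<open>Makes the code lengths \<open>- log 2 (q m)\<close> nonnegative, so that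
    \<open>ennreal\<close> does not truncate them.\<close>
  have q1: "q m \<le> 1" for m
  proof -
    have "ennreal (q m) \<le> (\<Sum>m. ennreal (q m))"
      using sum_le_suminf[of "\<lambda>m. ennreal (q m)" "{m}"] by simp
    with q(2) have "ennreal (q m) \<le> 1" by (rule order_trans[rotated])
    then show ?thesis by simp
  qed
  have "(\<Sum>m. ennreal (eta (measure \<mu> {x \<in> space \<mu>. f x z = m})))
      \<le> (\<Sum>m. ennreal (- log 2 (q m)) * emeasure \<mu> ((\<lambda>x. (x, z)) -` ?F m))" if z: "z \<in> space PZ" for z
  proof -
    define p where "p m = measure \<mu> {x \<in> space \<mu>. f x z = m}" for m
    have "(\<Sum>m. emeasure \<mu> {x \<in> space \<mu>. f x z = m}) = emeasure \<mu> (\<Union>m. {x \<in> space \<mu>. f x z = m})"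
      using Fz_sets[OF z] by (intro suminf_emeasure) (auto simp: disjoint_family_on_def)
    also have "(\<Union>m. {x \<in> space \<mu>. f x z = m}) = space \<mu>" by auto
    finally have p_sum: "(\<Sum>m. ennreal (p m)) = 1"
      by (simp add: X.prob_space X.emeasure_eq_measure p_def)
    let ?c = "ennreal (1 / ln 2)"
    have p: "0 \<le> p m" "p m \<le> 1" for m by (auto simp: p_def)
    have scale: "(\<Sum>m. ennreal (g m / ln 2)) = (\<Sum>m. ennreal (g m)) * ?c" if "\<And>m. 0 \<le> g m" for g :: "nat \<Rightarrow> real"
      using that by (subst ennreal_suminf_multc[symmetric]) (simp add: ennreal_mult[symmetric])
    have "(\<Sum>m. ennreal (eta (p m))) + ?c = (\<Sum>m. ennreal (eta (p m))) + (\<Sum>m. ennreal (p m / ln 2))"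
      by (subst scale[of p, OF p(1)]) (simp add: p_sum)
    also have "\<dots> = (\<Sum>m. ennreal (eta (p m)) + ennreal (p m / ln 2))"
      by (rule suminf_add) auto
    also have "\<dots> \<le> (\<Sum>m. ennreal (p m * (- log 2 (q m))) + ennreal (q m / ln 2))"
    proof (intro suminf_le)
      fix m
      have "0 \<le> p m * (- log 2 (q m))" using p q q1 by (intro mult_nonneg_nonneg) auto
      then show "ennreal (eta (p m)) + ennreal (p m / ln 2)
          \<le> ennreal (p m * (- log 2 (q m))) + ennreal (q m / ln 2)"
        using eta_le_cross[OF p(1) q(1), of m m] eta_nonneg[OF p] p q[of] less_imp_le[OF q(1), of m]
        by (simp add: ennreal_leI flip: ennreal_plus)
    qed auto
    also have "\<dots> = (\<Sum>m. ennreal (p m * (- log 2 (q m)))) + (\<Sum>m. ennreal (q m / ln 2))"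
      by (rule suminf_add[symmetric]) auto
    also have "\<dots> = (\<Sum>m. ennreal (p m * (- log 2 (q m)))) + (\<Sum>m. ennreal (q m)) * ?c"
      using q by (simp add: scale less_imp_le)
    also have "\<dots> \<le> (\<Sum>m. ennreal (p m * (- log 2 (q m)))) + 1 * ?c"
      using q by (intro add_mono mult_right_mono) auto
    finally have "(\<Sum>m. ennreal (eta (p m))) \<le> (\<Sum>m. ennreal (p m * (- log 2 (q m))))"
      by (simp add: add.commute[of _ ?c] ennreal_add_left_cancel_le)
    also have "\<dots> = (\<Sum>m. ennreal (- log 2 (q m)) * emeasure \<mu> ((\<lambda>x. (x, z)) -` ?F m))"
    proof (intro suminf_cong)
      fix m
      show "ennreal (p m * (- log 2 (q m))) = ennreal (- log 2 (q m)) * emeasure \<mu> ((\<lambda>x. (x, z)) -` ?F m)"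
        unfolding Fz[OF z] X.emeasure_eq_measure p_def[symmetric] mult.commute[of "p m"]
        using p(1) by (rule ennreal_mult'')
    qed
    finally show ?thesis unfolding p_def .
  qed
  then have "cond_entropy_enc \<mu> PZ f
      \<le> (\<integral>\<^sup>+z. (\<Sum>m. ennreal (- log 2 (q m)) * emeasure \<mu> ((\<lambda>x. (x, z)) -` ?F m)) \<partial>PZ)"
    unfolding cond_entropy_enc_def by (rule nn_integral_mono)
  also have "\<dots> = (\<Sum>m. ennreal (- log 2 (q m)) * (\<integral>\<^sup>+z. emeasure \<mu> ((\<lambda>x. (x, z)) -` ?F m) \<partial>PZ))"
    using measurable_emeasure_Pair2[OF F]
    by (subst nn_integral_suminf) (auto intro!: suminf_cong nn_integral_cmult)
  also have "\<dots> = (\<Sum>m. ennreal (- log 2 (q m)) * emeasure (\<mu> \<Otimes>\<^sub>M PZ) (?F m))"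
    by (simp add: emeasure_pair_measure_alt2[OF F])
  finally show ?thesis .
qed

text \<open>For positive \<open>k\<close> this is the integral of x powr (- 1 - 1 / a) over
  [k, k + 1], divided by 1 + a. The differences telescope, so the total mass is 1 without a zeta
  function. With this exponent a log-moment of \<open>a\<close> bits costs (1 + 1 / a) a = a + 1
  bits.\<close>

definition zipf_weight :: "real \<Rightarrow> nat \<Rightarrow> real" where
  "zipf_weight a k = (case k of 0 \<Rightarrow> 1 / (1 + a)
     | Suc j \<Rightarrow> a / (1 + a) * (real k powr (- 1 / a) - (real k + 1) powr (- 1 / a)))"

text \<open>A decreasing integrand over [k, k + 1] is at least its value at the right end. The proof
  replaces the integral by exp u \<ge> 1 + u, applied to the ratio of the two powers.\<close>

lemma zipf_weight_ge:
  assumes a: "0 < a"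
  shows "real (k + 1) powr (- 1 - 1 / a) / (1 + a) \<le> zipf_weight a k"
proof (cases k)
  case 0
  then show ?thesis by (simp add: zipf_weight_def)
next
  case (Suc j)
  define x where "x = real k"
  have x: "0 < x" using Suc by (simp add: x_def)
  let ?e = "1 / a"
  have "1 + ?e / (x + 1) \<le> 1 - ?e * ln (x / (x + 1))"
  proof -
    have "ln (x / (x + 1)) \<le> x / (x + 1) - 1" using x by (intro ln_le_minus_one) simp
    also have "\<dots> = - (1 / (x + 1))" using x by (simp add: field_simps)
    finally have "?e * ln (x / (x + 1)) \<le> ?e * (- (1 / (x + 1)))" using a by (intro mult_left_mono) auto
    then show ?thesis by simp
  qed
  also have "\<dots> \<le> exp (- ?e * ln (x / (x + 1)))"
    using exp_ge_add_one_self[of "- ?e * ln (x / (x + 1))"] by simp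
  also have "\<dots> = x powr (- ?e) / (x + 1) powr (- ?e)"
    using x by (simp add: powr_def ln_div right_diff_distrib exp_diff exp_minus field_simps)
  finally have "(1 + ?e / (x + 1)) * (x + 1) powr (- ?e) \<le> x powr (- ?e)"
    using x by (simp add: pos_le_divide_eq)
  then have "?e * ((x + 1) powr (- ?e) / (x + 1)) \<le> x powr (- ?e) - (x + 1) powr (- ?e)"
    by (simp add: algebra_simps)
  then have "a / (1 + a) * (?e * ((x + 1) powr (- ?e) / (x + 1)))
      \<le> a / (1 + a) * (x powr (- ?e) - (x + 1) powr (- ?e))"
    using a by (intro mult_left_mono) auto
  moreover have "(x + 1) powr (- 1 - ?e) = (x + 1) powr (- ?e) / (x + 1)"
  proof -
    have "- 1 - ?e = - ?e - 1" by simp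
    then show ?thesis using x powr_diff[of "x + 1" "- ?e" 1] by (simp only:) simp
  qed
  ultimately show ?thesis using a Suc by (simp add: zipf_weight_def x_def add.commute mult.commute)
qed

lemma zipf_weight_pos: "0 < a \<Longrightarrow> 0 < zipf_weight a k"
  by (rule less_le_trans[OF _ zipf_weight_ge]) auto

lemma zipf_weight_sum_le:
  assumes a: "0 < a"
  shows "(\<Sum>k<n. zipf_weight a k) \<le> 1"
proof -
  have "(\<Sum>k<Suc n. zipf_weight a k) = 1 - a / (1 + a) * (real n + 1) powr (- 1 / a)" for n
  proof (induction n)
    case 0
    then show ?case using a by (simp add: zipf_weight_def field_simps)
  next
    case (Suc n)
    then show ?case by (simp add: zipf_weight_def algebra_simps)
  qed
  moreover have "0 \<le> a / (1 + a) * (real n + 1) powr (- 1 / a)" for n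
    using a by simp
  ultimately show ?thesis by (cases n) (simp_all del: sum.lessThan_Suc)
qed

text \<open>The three costs are log s for the uniform residue, log (1 + a) for the normalisation of
  \<open>zipf_weight\<close> and a + 1 for its power law, as \<open>moment\<close> allows
  \<open>a\<close> bits for the expected logarithm of the round.\<close>

lemma cond_entropy_enc_le_log_moment:
  fixes f :: "'x \<Rightarrow> 'z \<Rightarrow> nat"
  assumes \<mu>: "prob_space \<mu>" and PZ: "prob_space PZ"
    and f: "(\<lambda>(x, z). f x z) \<in> \<mu> \<Otimes>\<^sub>M PZ \<rightarrow>\<^sub>M count_space UNIV"
    and s: "0 < s" and a: "0 < a"
    and moment: "(\<Sum>m. ennreal (ln (real (m div s + 1)))
        * emeasure (\<mu> \<Otimes>\<^sub>M PZ) {p \<in> space (\<mu> \<Otimes>\<^sub>M PZ). f (fst p) (snd p) = m}) \<le> ennreal (a * ln 2)"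
  shows "cond_entropy_enc \<mu> PZ f \<le> ennreal (log 2 (real s) + log 2 (1 + a) + a + 1)"
proof -
  interpret X: prob_space \<mu> by fact
  interpret Z: prob_space PZ by fact
  interpret pair_prob_space \<mu> PZ ..
  define E where "E m = emeasure (\<mu> \<Otimes>\<^sub>M PZ) {p \<in> space (\<mu> \<Otimes>\<^sub>M PZ). f (fst p) (snd p) = m}" for m
  define q where "q m = zipf_weight a (m div s) / real s" for m
  have q_pos: "0 < q m" for m using s by (simp add: q_def zipf_weight_pos[OF a])
  have q_sum: "(\<Sum>m. ennreal (q m)) \<le> 1"
  proof (rule suminf_le_const)
    fix N
    \<comment> \<open>Extending the range to \<open>N * s\<close> completes the rounds, each of
      which has total weight \<open>zipf_weight a k\<close>.\<close>
    have "(\<Sum>m<N. q m) \<le> (\<Sum>m<N * s. q m)"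
      using s q_pos by (intro sum_mono2) (auto simp: less_imp_le intro: less_le_trans)
    also have "\<dots> = (\<Sum>k<N. \<Sum>m\<in>{k * s..<k * s + s}. q m)" by (simp add: sum.nat_group)
    also have "\<dots> = (\<Sum>k<N. zipf_weight a k)"
    proof (rule sum.cong[OF refl])
      fix k
      have "(\<Sum>m\<in>{k * s..<k * s + s}. q m) = (\<Sum>m\<in>{k * s..<k * s + s}. zipf_weight a k / real s)"
      proof (rule sum.cong[OF refl])
        fix m assume "m \<in> {k * s..<k * s + s}"
        then have "m div s = k" by (intro div_nat_eqI) (auto simp: mult.commute)
        then show "q m = zipf_weight a k / real s" by (simp add: q_def)
      qed
      then show "(\<Sum>m\<in>{k * s..<k * s + s}. q m) = zipf_weight a k" using s by simp
    qed
    also have "\<dots> \<le> 1" by (rule zipf_weight_sum_le[OF a])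
    finally show "(\<Sum>m<N. ennreal (q m)) \<le> 1" using q_pos by (simp add: less_imp_le sum_nonneg)
  qed simp
  have f_sets: "{p \<in> space (\<mu> \<Otimes>\<^sub>M PZ). f (fst p) (snd p) = m} \<in> sets (\<mu> \<Otimes>\<^sub>M PZ)" for m
    using measurable_sets[OF f, of "{m}"] by (simp add: vimage_def Int_def split_beta conj_commute)
  have "(\<Sum>m. E m) = emeasure (\<mu> \<Otimes>\<^sub>M PZ) (\<Union>m. {p \<in> space (\<mu> \<Otimes>\<^sub>M PZ). f (fst p) (snd p) = m})"
    unfolding E_def using f_sets by (intro suminf_emeasure) (auto simp: disjoint_family_on_def)
  also have "(\<Union>m. {p \<in> space (\<mu> \<Otimes>\<^sub>M PZ). f (fst p) (snd p) = m}) = space (\<mu> \<Otimes>\<^sub>M PZ)" by auto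
  finally have E_sum: "(\<Sum>m. E m) = 1" by (simp add: P.emeasure_space_1)
  define c where "c = log 2 (real s) + log 2 (1 + a)"
  \<comment> \<open>The exponent 1 + 1 / a with the conversion from nats to bits, so that
    \<open>d * (a * ln 2) = a + 1\<close>.\<close>
  define d where "d = (1 + 1 / a) / ln 2"
  have c: "0 \<le> c" using s a by (simp add: c_def)
  have d: "0 \<le> d" using a by (simp add: d_def)
  have "- log 2 (q m) \<le> c + d * ln (real (m div s + 1))" for m
  proof -
    let ?k = "real (m div s + 1)"
    have "?k powr (- 1 - 1 / a) / (1 + a) / real s \<le> q m"
      unfolding q_def using zipf_weight_ge[OF a, of "m div s"] s by (intro divide_right_mono) auto
    moreover have "0 < ?k powr (- 1 - 1 / a) / (1 + a) / real s" using a s by simp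
    ultimately have "log 2 (?k powr (- 1 - 1 / a) / (1 + a) / real s) \<le> log 2 (q m)"
      by (subst log_le_cancel_iff) auto
    moreover have "log 2 (?k powr (- 1 - 1 / a) / (1 + a) / real s) = - c - d * ln ?k"
    proof -
      have ln_eq: "ln (?k powr (- 1 - 1 / a) / (1 + a) / real s) = (- 1 - 1 / a) * ln ?k - ln (1 + a) - ln (real s)"
        using a s by (simp add: ln_div ln_powr ln_mult)
      show ?thesis unfolding log_def c_def d_def ln_eq
        by (simp add: diff_divide_distrib add_divide_distrib algebra_simps)
    qed
    ultimately show ?thesis by linarith
  qed
  then have "ennreal (- log 2 (q m)) * E m \<le> ennreal c * E m + ennreal d * (ennreal (ln (real (m div s + 1))) * E m)" for m
  proof -
    have "ennreal (- log 2 (q m)) \<le> ennreal (c + d * ln (real (m div s + 1)))"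
      by (rule ennreal_leI) fact
    also have "\<dots> = ennreal c + ennreal d * ennreal (ln (real (m div s + 1)))"
      using c d by (subst ennreal_plus) (auto simp: ennreal_mult)
    finally have "ennreal (- log 2 (q m)) * E m \<le> (ennreal c + ennreal d * ennreal (ln (real (m div s + 1)))) * E m"
      by (intro mult_right_mono) auto
    then show ?thesis by (simp add: distrib_right mult.assoc)
  qed
  then have "(\<Sum>m. ennreal (- log 2 (q m)) * E m)
      \<le> (\<Sum>m. ennreal c * E m + ennreal d * (ennreal (ln (real (m div s + 1))) * E m))"
    by (intro suminf_le) auto
  also have "\<dots> = ennreal c * (\<Sum>m. E m) + ennreal d * (\<Sum>m. ennreal (ln (real (m div s + 1))) * E m)"
    by (simp flip: suminf_add)
  also have "\<dots> \<le> ennreal c + ennreal d * ennreal (a * ln 2)"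
    using moment unfolding E_sum by (intro add_mono mult_left_mono) (auto simp: E_def)
  also have "\<dots> = ennreal (c + d * (a * ln 2))"
    using a c d by (simp add: ennreal_mult ennreal_plus)
  also have "c + d * (a * ln 2) = log 2 (real s) + log 2 (1 + a) + a + 1"
    using a by (simp add: c_def d_def field_simps)
  finally show ?thesis
    using cond_entropy_enc_le_cross[OF \<mu> PZ f q_pos q_sum] unfolding E_def by (rule order_trans[rotated])
qed

section \<open>Relative entropy\<close>

text \<open>The last bound integrates \<open>cvx_potential_le\<close>. Since the divergence is a
  difference of two extended integrals, the estimates are arranged as sums in
  \<open>ennreal\<close>, and subtraction is performed only once both parts are known to be
  finite.\<close>

lemma kl_div_bounds:
  assumes P: "prob_space P" and Q: "prob_space Q" and kl: "kl_div P Q < \<infinity>"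
  shows "sets P = sets Q" "absolutely_continuous Q P"
    and "density Q (\<lambda>x. ennreal (enn2real (RN_deriv Q P x))) = P"
    and "\<exists>c\<ge>0. kl_div P Q = ereal c
      \<and> (\<integral>\<^sup>+x. ennreal (cvx_potential (enn2real (RN_deriv Q P x))) \<partial>Q) \<le> ennreal (c * ln 2 + 1 / 2)"
proof -
  interpret P: prob_space P by fact
  interpret Q: prob_space Q by fact
  show sets: "sets P = sets Q" and ac: "absolutely_continuous Q P"
    using kl by (auto simp: kl_div_def split: if_splits)
  define \<rho> where "\<rho> x = enn2real (RN_deriv Q P x)" for x
  have \<rho>_nonneg: "0 \<le> \<rho> x" for x by (simp add: \<rho>_def)
  have \<rho>_meas [measurable]: "\<rho> \<in> borel_measurable Q" unfolding \<rho>_def[abs_def] by measurable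
  have "density Q (\<lambda>x. ennreal (\<rho> x)) = density Q (RN_deriv Q P)"
    using Q.RN_deriv_finite[OF P.sigma_finite_measure_axioms ac sets]
    by (intro density_cong) (auto elim!: eventually_mono simp: \<rho>_def less_top)
  also have "\<dots> = P" by (rule Q.density_RN_deriv[OF ac sets])
  finally have dens: "density Q (\<lambda>x. ennreal (\<rho> x)) = P" .
  then show "density Q (\<lambda>x. ennreal (enn2real (RN_deriv Q P x))) = P" by (simp add: \<rho>_def)
  define A where "A = (\<integral>\<^sup>+x. ennreal (log 2 (\<rho> x)) \<partial>P)"
  define B where "B = (\<integral>\<^sup>+x. ennreal (- log 2 (\<rho> x)) \<partial>P)"
  have kl_eq: "kl_div P Q = enn2ereal A - enn2ereal B"
    using sets ac by (simp add: kl_div_def A_def B_def \<rho>_def)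
  have change: "ennreal (ln 2) * (\<integral>\<^sup>+x. ennreal (g x) \<partial>P) = (\<integral>\<^sup>+x. ennreal (\<rho> x * (g x * ln 2)) \<partial>Q)"
    if [measurable]: "g \<in> borel_measurable Q" for g
  proof -
    have "ennreal (ln 2) * (\<integral>\<^sup>+x. ennreal (g x) \<partial>P) = (\<integral>\<^sup>+x. ennreal (\<rho> x) * (ennreal (ln 2) * ennreal (g x)) \<partial>Q)"
      unfolding dens[symmetric]
      by (subst nn_integral_density) (auto simp: nn_integral_cmult[symmetric] ac_simps)
    also have "\<dots> = (\<integral>\<^sup>+x. ennreal (\<rho> x * (g x * ln 2)) \<partial>Q)"
    proof (rule nn_integral_cong)
      fix x
      show "ennreal (\<rho> x) * (ennreal (ln 2) * ennreal (g x)) = ennreal (\<rho> x * (g x * ln 2))"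
        by (simp add: ennreal_mult' ennreal_mult'' \<rho>_nonneg mult.commute)
    qed
    finally show ?thesis .
  qed
  have A: "ennreal (ln 2) * A = (\<integral>\<^sup>+x. ennreal (\<rho> x * ln (\<rho> x)) \<partial>Q)"
    unfolding A_def by (subst change) (simp_all add: log_def)
  have B: "ennreal (ln 2) * B = (\<integral>\<^sup>+x. ennreal (- (\<rho> x * ln (\<rho> x))) \<partial>Q)"
    unfolding B_def by (subst change) (simp_all add: log_def)
  have total: "(\<integral>\<^sup>+x. ennreal (\<rho> x) \<partial>Q) = 1"
  proof -
    have "(\<integral>\<^sup>+x. ennreal (\<rho> x) \<partial>Q) = emeasure (density Q (\<lambda>x. ennreal (\<rho> x))) (space Q)"
      by (subst emeasure_density) (auto intro!: nn_integral_cong)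
    also have "\<dots> = 1"
      using P.emeasure_space_1 sets_eq_imp_space_eq[OF sets] by (simp add: dens)
    finally show ?thesis .
  qed
  \<comment> \<open>\<open>ennreal b\<close> and \<open>ennreal (- b)\<close> are the positive and
    the negative part of \<open>b\<close>; the negative part moves to the left.\<close>
  have split: "ennreal a + ennreal (- b) \<le> ennreal b + ennreal d"
    if "0 \<le> a" "0 \<le> d" "a \<le> b + d" for a b d :: real
    using that by (cases "0 \<le> b") (auto simp: ennreal_neg ennreal_leI simp flip: ennreal_plus)
  define K where "K = (\<integral>\<^sup>+x. ennreal (cvx_potential (\<rho> x)) \<partial>Q)"
  have "K + ennreal (ln 2) * B = (\<integral>\<^sup>+x. ennreal (cvx_potential (\<rho> x)) + ennreal (- (\<rho> x * ln (\<rho> x))) \<partial>Q)"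
    unfolding B K_def by (rule nn_integral_add[symmetric]) measurable
  also have "\<dots> \<le> (\<integral>\<^sup>+x. ennreal (\<rho> x * ln (\<rho> x)) + ennreal (1 / 2) \<partial>Q)"
    using cvx_potential_nonneg cvx_potential_le \<rho>_nonneg by (intro nn_integral_mono split) auto
  also have "\<dots> = ennreal (ln 2) * A + ennreal (1 / 2)"
    unfolding A by (subst nn_integral_add) (auto simp: Q.emeasure_space_1)
  finally have K: "K + ennreal (ln 2) * B \<le> ennreal (ln 2) * A + ennreal (1 / 2)" .
  \<comment> \<open>Integrating \<rho> - 1 \<le> \<rho> ln \<rho> shows that the divergence is
    nonnegative; the mass 1 is added on both sides instead of being subtracted.\<close>
  have "1 + ennreal (ln 2) * B = (\<integral>\<^sup>+x. ennreal (\<rho> x) + ennreal (- (\<rho> x * ln (\<rho> x))) \<partial>Q)"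
    unfolding B total[symmetric] by (rule nn_integral_add[symmetric]) measurable
  also have "\<dots> \<le> (\<integral>\<^sup>+x. ennreal (\<rho> x * ln (\<rho> x)) + ennreal 1 \<partial>Q)"
  proof (intro nn_integral_mono split \<rho>_nonneg)
    fix x
    show "\<rho> x \<le> \<rho> x * ln (\<rho> x) + 1"
      using xlnx_tangent[of 1 "\<rho> x"] \<rho>_nonneg[of x] by simp
  qed simp
  also have "\<dots> = 1 + ennreal (ln 2) * A"
    unfolding A by (subst nn_integral_add) (auto simp: Q.emeasure_space_1 add.commute)
  finally have BA: "1 + ennreal (ln 2) * B \<le> 1 + ennreal (ln 2) * A" .
  \<comment> \<open>In \<open>ereal\<close> the difference of two infinities is \<infinity>, so a
    finite divergence excludes an infinite \<open>A\<close> whatever \<open>B\<close> is.\<close>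
  have "A \<noteq> \<top>"
    using kl unfolding kl_eq by (cases B rule: ennreal_cases) (auto simp: top_ereal_def)
  then obtain a where a: "A = ennreal a" "0 \<le> a" by (cases A rule: ennreal_cases) auto
  have "B \<noteq> \<top>" using K a by (auto simp: ennreal_mult_top top_unique simp flip: ennreal_mult ennreal_plus)
  then obtain b where b: "B = ennreal b" "0 \<le> b" by (cases B rule: ennreal_cases) auto
  have "ennreal (1 + ln 2 * b) \<le> ennreal (1 + ln 2 * a)"
    using BA a b by (simp add: ennreal_mult ennreal_plus)
  then have "1 + ln 2 * b \<le> 1 + ln 2 * a"
    by (subst (asm) ennreal_le_iff) (use a in auto)
  then have ab: "b \<le> a" by simp
  have "K + ennreal (ln 2 * b) \<le> ennreal (ln 2 * a + 1 / 2)"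
    using K a b by (simp add: ennreal_mult ennreal_plus)
  moreover have "ln 2 * a + 1 / 2 = ((a - b) * ln 2 + 1 / 2) + ln 2 * b" by (simp add: algebra_simps)
  ultimately have "K + ennreal (ln 2 * b) \<le> ennreal ((a - b) * ln 2 + 1 / 2) + ennreal (ln 2 * b)"
    using ab b by (simp add: ennreal_plus)
  then have "K \<le> ennreal ((a - b) * ln 2 + 1 / 2)"
    by (simp add: add.commute[of _ "ennreal (ln 2 * b)"] ennreal_add_left_cancel_le)
  moreover have "kl_div P Q = ereal (a - b)"
    using a b by (simp add: kl_eq enn2ereal_ennreal)
  ultimately show "\<exists>c\<ge>0. kl_div P Q = ereal c
      \<and> (\<integral>\<^sup>+x. ennreal (cvx_potential (enn2real (RN_deriv Q P x))) \<partial>Q) \<le> ennreal (c * ln 2 + 1 / 2)"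
    using ab unfolding K_def \<rho>_def by (intro exI[of _ "a - b"]) auto
qed

lemma kl_div_nonneg:
  assumes "prob_space P" "prob_space Q"
  shows "0 \<le> kl_div P Q"
proof (cases "kl_div P Q < \<infinity>")
  case True
  then show ?thesis using kl_div_bounds(4)[OF assms] by force
qed simp

section \<open>Common randomness in the space of real sequences\<close>

text \<open>A point of a Polish space is encoded by its distances to a dense sequence \<open>q\<close>, and it is
  recovered as the limit of the first members of \<open>q\<close> that are \<open>1 / (k + 1)\<close>-close to it.\<close>

lemma polish_encoding:
  obtains e :: "'y::polish_space \<Rightarrow> nat \<Rightarrow> real" and d :: "(nat \<Rightarrow> real) \<Rightarrow> 'y"
  where "\<And>i. (\<lambda>y. e y i) \<in> borel_measurable borel"
    and "d \<in> (\<Pi>\<^sub>M i\<in>UNIV. borel) \<rightarrow>\<^sub>M borel"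
    and "\<And>y. d (e y) = y"
proof -
  obtain D :: "'y set" where D: "countable D" "\<And>X. open X \<Longrightarrow> X \<noteq> {} \<Longrightarrow> \<exists>d\<in>D. d \<in> X"
    using countable_dense_setE by blast
  then have "D \<noteq> {}" by blast
  define q where "q = from_nat_into D"
  have range_q: "range q = D" using D(1) \<open>D \<noteq> {}\<close> by (simp add: q_def)
  define e where "e y i = dist y (q i)" for y :: 'y and i
  define approx where "approx k z = q (LEAST i. z i < 1 / (real k + 1))" for k and z :: "nat \<Rightarrow> real"
  \<comment> \<open>The fallback to \<open>q 0\<close> makes the sequence converge for every
    \<open>z\<close>, also outside the range of \<open>e\<close>, so \<open>d\<close> is a pointwise
    limit of measurable functions.\<close>
  define d where "d z = lim (\<lambda>k. if Cauchy (\<lambda>k. approx k z) then approx k z else q 0)" for z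
  have [measurable]: "approx k \<in> (\<Pi>\<^sub>M i\<in>UNIV. borel) \<rightarrow>\<^sub>M borel" for k
    unfolding approx_def by measurable
  have "d \<in> (\<Pi>\<^sub>M i\<in>UNIV. borel) \<rightarrow>\<^sub>M borel"
  proof (rule borel_measurable_LIMSEQ_metric)
    fix z :: "nat \<Rightarrow> real"
    have "convergent (\<lambda>k. if Cauchy (\<lambda>k. approx k z) then approx k z else q 0)"
      by (cases "Cauchy (\<lambda>k. approx k z)") (auto simp: Cauchy_convergent_iff convergent_const)
    then show "(\<lambda>k. if Cauchy (\<lambda>k. approx k z) then approx k z else q 0) \<longlonglongrightarrow> d z"
      unfolding d_def by (rule convergent_LIMSEQ_iff[THEN iffD1])
  qed measurable
  moreover have "d (e y) = y" for y
  proof -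
    have "dist (approx k (e y)) y < 1 / (real k + 1)" for k
    proof -
      obtain a where "a \<in> D" "a \<in> ball y (1 / (real k + 1))"
        using D(2)[of "ball y (1 / (real k + 1))"] by auto
      moreover then obtain i where "a = q i" using range_q by blast
      ultimately have "\<exists>i. e y i < 1 / (real k + 1)" by (auto simp: e_def)
      then have "e y (LEAST i. e y i < 1 / (real k + 1)) < 1 / (real k + 1)" by (rule LeastI_ex)
      then show ?thesis by (simp add: e_def approx_def dist_commute)
    qed
    then have "(\<lambda>k. dist (approx k (e y)) y) \<longlonglongrightarrow> 0"
    proof (intro Lim_null_comparison[OF _ LIMSEQ_inverse_real_of_nat] always_eventually allI)
      fix k
      have "dist (approx k (e y)) y < 1 / (real k + 1)" by fact
      then show "norm (dist (approx k (e y)) y) \<le> inverse (real (Suc k))"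
        by (simp add: inverse_eq_divide add.commute)
    qed
    then have lim: "(\<lambda>k. approx k (e y)) \<longlonglongrightarrow> y" by (rule tendsto_dist_iff[THEN iffD2])
    then have "Cauchy (\<lambda>k. approx k (e y))" by (rule LIMSEQ_imp_Cauchy)
    then show ?thesis using limI[OF lim] by (simp add: d_def)
  qed
  moreover have "(\<lambda>y. e y i) \<in> borel_measurable borel" for i
    unfolding e_def by measurable
  ultimately show ?thesis using that by blast
qed

text \<open>Runs of proposals are sequences over \<open>'y \<times> real\<close>, while common
  randomness must be a real sequence. \<open>E\<close> codes a run by reals with measurable left
  inverse \<open>D\<close>, and \<open>PZ\<close> is the law of the coded run.\<close>

lemma realize_in_crand:
  fixes \<Omega> :: "(nat \<Rightarrow> 'y::polish_space \<times> real) measure"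
  assumes \<Omega>: "prob_space \<Omega>" "sets \<Omega> = sets (\<Pi>\<^sub>M n\<in>(UNIV::nat set). (borel :: ('y \<times> real) measure))"
  obtains PZ :: "crand measure" and D :: "crand \<Rightarrow> nat \<Rightarrow> 'y \<times> real"
  where "prob_space PZ" "sets PZ = sets borel" "D \<in> borel \<rightarrow>\<^sub>M (\<Pi>\<^sub>M n\<in>UNIV. borel)" "distr PZ \<Omega> D = \<Omega>"
proof -
  interpret \<Omega>: prob_space \<Omega> by fact
  obtain e :: "'y \<Rightarrow> nat \<Rightarrow> real" and d :: "(nat \<Rightarrow> real) \<Rightarrow> 'y"
    where e [measurable]: "\<And>i. (\<lambda>y. e y i) \<in> borel_measurable borel"
      and d [measurable]: "d \<in> (\<Pi>\<^sub>M i\<in>UNIV. borel) \<rightarrow>\<^sub>M borel" and de: "\<And>y. d (e y) = y"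
    using polish_encoding by blast
  let ?P = "\<Pi>\<^sub>M n\<in>(UNIV::nat set). (borel :: ('y \<times> real) measure)"
  let ?Z = "\<Pi>\<^sub>M i\<in>(UNIV::nat set). (borel :: real measure)"
  have Z: "sets ?Z = sets borel" by (rule sets_PiM_equal_borel)
  \<comment> \<open>Coordinate (n, 0) stores the uniform variable of proposal \<open>n\<close>, and
    (n, Suc j) the \<open>j\<close>-th real encoding its point of \<open>'y\<close>.\<close>
  define E where "E \<omega> i = (case prod_decode i of (n, k) \<Rightarrow>
      (case k of 0 \<Rightarrow> snd (\<omega> n) | Suc j \<Rightarrow> e (fst (\<omega> n)) j))" for \<omega> :: "nat \<Rightarrow> 'y \<times> real" and i
  define D where "D z n = (d (\<lambda>j. z (prod_encode (n, Suc j))), z (prod_encode (n, 0)))"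
    for z :: "nat \<Rightarrow> real" and n
  have DE: "D (E \<omega>) = \<omega>" for \<omega> by (rule ext) (simp add: D_def E_def de)
  have "E \<in> ?P \<rightarrow>\<^sub>M ?Z"
  proof (rule measurable_PiM_single')
    fix i
    obtain n k where i: "prod_decode i = (n, k)" by (cases "prod_decode i")
    have [measurable]: "(\<lambda>\<omega>. \<omega> n) \<in> ?P \<rightarrow>\<^sub>M borel" by measurable
    have "(fst :: 'y \<times> real \<Rightarrow> 'y) \<in> borel_measurable borel"
      by (intro borel_measurable_continuous_onI continuous_intros)
    then have [measurable]: "(\<lambda>\<omega>. fst (\<omega> n)) \<in> ?P \<rightarrow>\<^sub>M borel"
      by (rule measurable_compose[rotated]) measurable
    have "(snd :: 'y \<times> real \<Rightarrow> real) \<in> borel_measurable borel"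
      by (intro borel_measurable_continuous_onI continuous_intros)
    then have [measurable]: "(\<lambda>\<omega>. snd (\<omega> n)) \<in> ?P \<rightarrow>\<^sub>M borel"
      by (rule measurable_compose[rotated]) measurable
    show "(\<lambda>\<omega>. E \<omega> i) \<in> ?P \<rightarrow>\<^sub>M borel"
      by (cases k) (simp_all add: E_def i)
  qed (auto simp: space_PiM)
  then have E: "E \<in> \<Omega> \<rightarrow>\<^sub>M borel" by (simp only: measurable_cong_sets[OF \<Omega>(2) Z[symmetric]])
  have "D \<in> ?Z \<rightarrow>\<^sub>M ?P"
  proof (rule measurable_PiM_single')
    fix n
    have "(\<lambda>z. (\<lambda>j. z (prod_encode (n, Suc j)))) \<in> ?Z \<rightarrow>\<^sub>M ?Z"
      by (rule measurable_PiM_single') (auto simp: space_PiM)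
    from measurable_compose[OF this d]
    show "(\<lambda>z. D z n) \<in> ?Z \<rightarrow>\<^sub>M borel" unfolding D_def by (intro borel_measurable_Pair) simp_all
  qed (auto simp: space_PiM)
  then have D: "D \<in> borel \<rightarrow>\<^sub>M ?P" by (simp only: measurable_cong_sets[OF Z[symmetric] refl])
  then have D': "D \<in> borel \<rightarrow>\<^sub>M \<Omega>" by (simp only: measurable_cong_sets[OF refl \<Omega>(2)])
  have "distr (distr \<Omega> borel E) \<Omega> D = distr \<Omega> \<Omega> (\<lambda>\<omega>. \<omega>)"
    by (subst distr_distr[OF D' E]) (simp add: comp_def DE)
  then have "distr (distr \<Omega> borel E) \<Omega> D = \<Omega>" by simp
  with \<Omega>.prob_space_distr[OF E] D show ?thesis by (intro that[of "distr \<Omega> borel E" D]) auto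
qed

section \<open>A common conditional density\<close>

lemma kernels_subprob: "Q \<in> kernels \<Longrightarrow> Q \<in> borel \<rightarrow>\<^sub>M subprob_algebra borel"
  unfolding kernels_def by (auto intro: measurable_prob_algebraD)

lemma kernels_prob:
  assumes "Q \<in> kernels"
  shows "prob_space (Q x)" "sets (Q x) = sets borel"
proof -
  have "Q x \<in> space (prob_algebra borel)"
    using assms unfolding kernels_def by (auto intro: measurable_space)
  then show "prob_space (Q x)" "sets (Q x) = sets borel" by (auto simp: space_prob_algebra)
qed

context
  fixes Q :: "'x::polish_space \<Rightarrow> 'y::polish_space measure" and \<mu> :: "'x measure"
  assumes Q: "Q \<in> kernels" and \<mu>: "sets \<mu> = sets borel"
begin

lemma joint_kernel_measurable:
  "(\<lambda>x. distr (Q x) borel (\<lambda>y. (x, y))) \<in> \<mu> \<rightarrow>\<^sub>M subprob_algebra borel"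
proof -
  have "case_prod (\<lambda>x y. (x, y)) \<in> borel \<Otimes>\<^sub>M borel \<rightarrow>\<^sub>M (borel :: ('x \<times> 'y) measure)"
    by (simp add: borel_prod)
  from measurable_distr2[OF this kernels_subprob[OF Q]]
  show ?thesis by (simp only: measurable_cong_sets[OF \<mu> refl])
qed

lemma sets_joint: "sets (joint \<mu> Q) = sets borel"
  unfolding joint_def using sets_eq_imp_space_eq[OF \<mu>] by (intro sets_bind) auto

lemma nn_integral_joint:
  assumes f: "f \<in> borel_measurable borel"
  shows "(\<integral>\<^sup>+z. f z \<partial>joint \<mu> Q) = (\<integral>\<^sup>+x. \<integral>\<^sup>+y. f (x, y) \<partial>Q x \<partial>\<mu>)"
proof -
  have "(\<lambda>y. (x, y)) \<in> Q x \<rightarrow>\<^sub>M borel" for x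
    by (simp only: measurable_cong_sets[OF kernels_prob(2)[OF Q] refl]) 
      (intro borel_measurable_Pair; simp)
  then show ?thesis
    unfolding joint_def using f
    by (subst nn_integral_bind[OF f joint_kernel_measurable]) (simp add: nn_integral_distr)
qed

lemma distr_fst_joint: "distr (joint \<mu> Q) borel fst = \<mu>"
proof (rule measure_eqI)
  fix A assume "A \<in> sets (distr (joint \<mu> Q) borel fst)"
  then have A: "A \<in> sets borel" by simp
  have f: "fst \<in> (borel :: ('x \<times> 'y) measure) \<rightarrow>\<^sub>M borel"
    by (intro borel_measurable_continuous_onI continuous_intros)
  then have f': "fst \<in> joint \<mu> Q \<rightarrow>\<^sub>M borel" by (simp only: measurable_cong_sets[OF sets_joint refl])
  have "emeasure (distr (joint \<mu> Q) borel fst) A = (\<integral>\<^sup>+x. indicator A x \<partial>distr (joint \<mu> Q) borel fst)"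
    using A by simp
  also have "\<dots> = (\<integral>\<^sup>+z. indicator A (fst z) \<partial>joint \<mu> Q)"
    using A f' by (intro nn_integral_distr) auto
  also have "\<dots> = (\<integral>\<^sup>+x. \<integral>\<^sup>+y. indicator A x \<partial>Q x \<partial>\<mu>)"
    using A by (subst nn_integral_joint) (auto intro: measurable_compose[OF f])
  also have "\<dots> = emeasure \<mu> A"
    using A \<mu> prob_space.emeasure_space_1[OF kernels_prob(1)[OF Q]] by simp
  finally show "emeasure (distr (joint \<mu> Q) borel fst) A = emeasure \<mu> A" .
qed (simp add: \<mu>)

lemma prob_space_joint: "prob_space \<mu> \<Longrightarrow> prob_space (joint \<mu> Q)"
proof (rule prob_spaceI)
  assume "prob_space \<mu>"
  then interpret prob_space \<mu> .
  have "emeasure (joint \<mu> Q) (space (joint \<mu> Q)) = (\<integral>\<^sup>+z. 1 \<partial>joint \<mu> Q)" by simp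
  also have "\<dots> = 1"
    using prob_space.emeasure_space_1[OF kernels_prob(1)[OF Q]]
    by (subst nn_integral_joint) (auto simp: emeasure_space_1)
  finally show "emeasure (joint \<mu> Q) (space (joint \<mu> Q)) = 1" .
qed

end

text \<open>Binding over a counting measure adds up the measures \<open>N i\<close> for \<open>i < s\<close>.\<close>

definition measure_sum :: "nat \<Rightarrow> (nat \<Rightarrow> 'a measure) \<Rightarrow> 'a measure" where
  "measure_sum s N = count_space {..<s} \<bind> N"

context
  fixes s :: nat and N :: "nat \<Rightarrow> 'a measure" and B :: "'a measure"
  assumes s: "0 < s" and N: "\<And>i. i < s \<Longrightarrow> prob_space (N i)" "\<And>i. i < s \<Longrightarrow> sets (N i) = sets B"
begin

lemma measure_sum_kernel: "N \<in> count_space {..<s} \<rightarrow>\<^sub>M subprob_algebra B"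
  using N by (auto simp: space_subprob_algebra intro: prob_space_imp_subprob_space)

lemma sets_measure_sum: "sets (measure_sum s N) = sets B"
  unfolding measure_sum_def using s N by (intro sets_bind) auto

lemma nn_integral_measure_sum:
  "f \<in> borel_measurable B \<Longrightarrow> (\<integral>\<^sup>+x. f x \<partial>measure_sum s N) = (\<Sum>i<s. \<integral>\<^sup>+x. f x \<partial>N i)"
  unfolding measure_sum_def
  by (subst nn_integral_bind[OF _ measure_sum_kernel]) (auto simp: nn_integral_count_space_finite)

lemma emeasure_measure_sum:
  assumes "A \<in> sets B"
  shows "emeasure (measure_sum s N) A = (\<Sum>i<s. emeasure (N i) A)"
  using nn_integral_measure_sum[of "indicator A"] assms N by (simp add: sets_measure_sum)

lemma finite_measure_measure_sum: "finite_measure (measure_sum s N)"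
proof (rule finite_measureI)
  have "emeasure (measure_sum s N) (space B) = (\<Sum>i<s. emeasure (N i) (space B))"
    by (rule emeasure_measure_sum) simp
  also have "\<dots> = (\<Sum>i<s. 1)"
  proof (rule sum.cong[OF refl])
    fix i assume "i \<in> {..<s}"
    then show "emeasure (N i) (space B) = 1"
      using prob_space.emeasure_space_1[OF N(1)] sets_eq_imp_space_eq[OF N(2)] by simp
  qed
  finally show "emeasure (measure_sum s N) (space (measure_sum s N)) \<noteq> \<infinity>"
    using sets_eq_imp_space_eq[OF sets_measure_sum] by simp
qed

lemma absolutely_continuous_measure_sum:
  assumes "i < s"
  shows "absolutely_continuous (measure_sum s N) (N i)"
  unfolding absolutely_continuous_def
proof (rule subsetI)
  fix A assume "A \<in> null_sets (measure_sum s N)"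
  then have A: "A \<in> sets B" "(\<Sum>i<s. emeasure (N i) A) = 0"
    by (auto simp: null_sets_def sets_measure_sum emeasure_measure_sum)
  then have "emeasure (N i) A = 0" using assms by simp
  then show "A \<in> null_sets (N i)" using A N(2)[OF assms] by (auto simp: null_sets_def)
qed

text \<open>The Radon-Nikodym derivatives are corrected on a null set, so that they sum to one everywhere.\<close>

lemma measure_sum_weights:
  obtains w :: "nat \<Rightarrow> 'a \<Rightarrow> real"
  where "\<And>i. w i \<in> borel_measurable B" "\<And>i x. 0 \<le> w i x" "\<And>x. (\<Sum>i<s. w i x) = 1"
    and "\<And>i. i < s \<Longrightarrow> density (measure_sum s N) (\<lambda>x. ennreal (w i x)) = N i"
proof -
  let ?L = "measure_sum s N"
  interpret L: finite_measure ?L by (rule finite_measure_measure_sum)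
  note [measurable_cong] = sets_measure_sum
  define w' where "w' i x = enn2real (RN_deriv ?L (N i) x)" for i x
  have [measurable]: "w' i \<in> borel_measurable ?L" for i unfolding w'_def[abs_def] by measurable
  have dens: "density ?L (\<lambda>x. ennreal (w' i x)) = N i" if i: "i < s" for i
  proof -
    have sets: "sets (N i) = sets ?L" using N(2)[OF i] by (simp add: sets_measure_sum)
    interpret Ni: prob_space "N i" by (rule N(1)[OF i])
    have "density ?L (\<lambda>x. ennreal (w' i x)) = density ?L (RN_deriv ?L (N i))"
      using L.RN_deriv_finite[OF Ni.sigma_finite_measure_axioms absolutely_continuous_measure_sum[OF i] sets]
      by (intro density_cong) (auto elim!: eventually_mono simp: w'_def less_top)
    then show ?thesis using L.density_RN_deriv[OF absolutely_continuous_measure_sum[OF i] sets] by simp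
  qed
  have w'_nonneg: "0 \<le> w' i x" for i x by (simp add: w'_def)
  have "density ?L (\<lambda>x. ennreal (\<Sum>i<s. w' i x)) = density ?L (\<lambda>x. 1)"
  proof (rule measure_eqI)
    fix A assume "A \<in> sets (density ?L (\<lambda>x. ennreal (\<Sum>i<s. w' i x)))"
    then have [measurable]: "A \<in> sets ?L" by simp
    have "emeasure (density ?L (\<lambda>x. ennreal (\<Sum>i<s. w' i x))) A
        = (\<integral>\<^sup>+x. (\<Sum>i<s. ennreal (w' i x) * indicator A x) \<partial>?L)"
      using w'_nonneg by (subst emeasure_density) (auto simp: sum_distrib_right simp flip: sum_ennreal)
    also have "\<dots> = (\<Sum>i<s. \<integral>\<^sup>+x. ennreal (w' i x) * indicator A x \<partial>?L)"
      by (rule nn_integral_sum) measurable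
    also have "\<dots> = (\<Sum>i<s. emeasure (density ?L (\<lambda>x. ennreal (w' i x))) A)"
      by (simp add: emeasure_density)
    also have "\<dots> = emeasure ?L A"
      using \<open>A \<in> sets ?L\<close> by (simp add: dens emeasure_measure_sum sets_measure_sum)
    finally show "emeasure (density ?L (\<lambda>x. ennreal (\<Sum>i<s. w' i x))) A = emeasure (density ?L (\<lambda>x. 1)) A"
      by (simp add: density_1)
  qed simp
  then have "AE x in ?L. ennreal (\<Sum>i<s. w' i x) = 1"
    by (intro L.density_unique) auto
  then have AE1: "AE x in ?L. (\<Sum>i<s. w' i x) = 1" by simp
  define w where "w i x = (if (\<Sum>i<s. w' i x) = 1 then w' i x else if i = 0 then 1 else 0)" for i x
  have w_meas: "w i \<in> borel_measurable ?L" for i unfolding w_def by measurable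
  have "w i \<in> borel_measurable B" for i using w_meas[of i] by measurable
  moreover have "0 \<le> w i x" for i x using w'_nonneg by (simp add: w_def)
  moreover have "(\<Sum>i<s. w i x) = 1" for x
    using s by (cases "(\<Sum>i<s. w' i x) = 1") (simp_all add: w_def)
  moreover have "density ?L (\<lambda>x. ennreal (w i x)) = N i" if "i < s" for i
  proof -
    have "density ?L (\<lambda>x. ennreal (w i x)) = density ?L (\<lambda>x. ennreal (w' i x))"
      using AE1 w_meas by (intro density_cong) (auto elim!: eventually_mono simp: w_def)
    then show ?thesis using dens[OF that] by simp
  qed
  ultimately show ?thesis by (rule that)
qed

end

text \<open>\<open>r\<close> is the density of the sum of all joint laws with respect to the product
  of the summed source laws and \<open>L\<close>, the sum of the output marginals, so it is chosen
  without reference to a source. It exists because finite mutual information makes each joint law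
  absolutely continuous with respect to the product of its own marginals, which the product of the
  sums dominates.\<close>

lemma common_density:
  fixes p :: "nat \<Rightarrow> 'x::polish_space measure" and Q :: "'x \<Rightarrow> 'y::polish_space measure"
  assumes s: "0 < s" and p: "\<And>i. i < s \<Longrightarrow> prob_space (p i)" "\<And>i. i < s \<Longrightarrow> sets (p i) = sets borel"
    and Q: "Q \<in> kernels" and MI: "\<And>i. i < s \<Longrightarrow> MI (p i) Q \<le> ereal c"
  obtains L :: "'y measure" and w :: "nat \<Rightarrow> 'y \<Rightarrow> real" and r :: "'x \<Rightarrow> 'y \<Rightarrow> real"
  where "finite_measure L" "sets L = sets borel"
    and "\<And>i. w i \<in> borel_measurable borel" "\<And>i y. 0 \<le> w i y" "\<And>y. (\<Sum>i<s. w i y) = 1"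
    and "\<And>i. i < s \<Longrightarrow> (\<integral>\<^sup>+y. ennreal (w i y) \<partial>L) = 1"
    and "case_prod r \<in> borel_measurable (borel \<Otimes>\<^sub>M borel)" "\<And>x y. 0 \<le> r x y"
    and "\<And>i. i < s \<Longrightarrow> AE x in p i. (\<integral>\<^sup>+y. ennreal (r x y) \<partial>L) = 1"
    and "\<And>i A. i < s \<Longrightarrow> A \<in> sets borel \<Longrightarrow>
        emeasure (joint (p i) Q) A = (\<integral>\<^sup>+x. \<integral>\<^sup>+y. ennreal (r x y) * indicator A (x, y) \<partial>L \<partial>p i)"
    and "\<And>i. i < s \<Longrightarrow> (\<integral>\<^sup>+x. \<integral>\<^sup>+y. ennreal (cvx_potential (r x y)) \<partial>L \<partial>p i) \<le> ennreal (c * ln 2 + 1 / 2)"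
proof -
  define J where "J i = joint (p i) Q" for i
  define P where "P i = distr (J i) borel snd" for i
  have J_sets: "sets (J i) = sets (borel \<Otimes>\<^sub>M borel)" if "i < s" for i
    using sets_joint[OF Q p(2)[OF that]] unfolding J_def borel_prod .
  have J_prob: "prob_space (J i)" if "i < s" for i
    using prob_space_joint[OF Q p(2)[OF that] p(1)[OF that]] by (simp add: J_def)
  have P_sets: "sets (P i) = sets borel" for i by (simp add: P_def)
  have P_prob: "prob_space (P i)" if "i < s" for i
    unfolding P_def using J_sets[OF that]
    by (intro prob_space.prob_space_distr J_prob that) (simp add: measurable_cong_sets[OF J_sets[OF that] refl])
  define L where "L = measure_sum s P"
  define m where "m = measure_sum s p"
  define T where "T = measure_sum s J"
  have L: "sets L = sets (borel)" "finite_measure L"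
    and L_int: "\<And>f. f \<in> borel_measurable (borel) \<Longrightarrow> (\<integral>\<^sup>+z. f z \<partial>L) = (\<Sum>i<s. \<integral>\<^sup>+z. f z \<partial>P i)"
    unfolding L_def
    by (rule sets_measure_sum finite_measure_measure_sum nn_integral_measure_sum; use s P_prob P_sets in auto)+
  have m: "sets m = sets (borel)" "finite_measure m"
    and m_int: "\<And>f. f \<in> borel_measurable (borel) \<Longrightarrow> (\<integral>\<^sup>+z. f z \<partial>m) = (\<Sum>i<s. \<integral>\<^sup>+z. f z \<partial>p i)"
    unfolding m_def
    by (rule sets_measure_sum finite_measure_measure_sum nn_integral_measure_sum; use s p in auto)+
  have T: "sets T = sets (borel \<Otimes>\<^sub>M borel)" "finite_measure T"
    and T_int: "\<And>f. f \<in> borel_measurable (borel \<Otimes>\<^sub>M borel) \<Longrightarrow> (\<integral>\<^sup>+z. f z \<partial>T) = (\<Sum>i<s. \<integral>\<^sup>+z. f z \<partial>J i)"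
    unfolding T_def
    by (rule sets_measure_sum finite_measure_measure_sum nn_integral_measure_sum; use s J_prob J_sets in auto)+
  interpret L: finite_measure L by (rule L(2))
  interpret m: finite_measure m by (rule m(2))
  interpret T: finite_measure T by (rule T(2))
  interpret mL: pair_sigma_finite m L ..
  note [measurable_cong] = L(1) m(1) T(1) P_sets
  obtain w where w: "\<And>i. w i \<in> borel_measurable borel" "\<And>i x. 0 \<le> w i x" "\<And>x. (\<Sum>i<s. w i x) = 1"
    and w_dens: "\<And>i. i < s \<Longrightarrow> density L (\<lambda>x. ennreal (w i x)) = P i"
    using measure_sum_weights[where N=P, OF s P_prob P_sets] unfolding L_def by metis
  note [measurable] = w(1)
  have int_w: "(\<integral>\<^sup>+y. ennreal (w i y) * g y \<partial>L) = (\<integral>\<^sup>+y. g y \<partial>P i)"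
    if "i < s" and [measurable]: "g \<in> borel_measurable borel" for i g
    unfolding w_dens[OF \<open>i < s\<close>, symmetric] by (rule nn_integral_density[symmetric]) measurable

  have fubini: "(\<integral>\<^sup>+z. f z \<partial>(N \<Otimes>\<^sub>M L)) = (\<integral>\<^sup>+x. \<integral>\<^sup>+y. f (x, y) \<partial>L \<partial>N)"
    if [measurable_cong]: "sets N = sets borel" and [measurable]: "f \<in> borel_measurable (borel \<Otimes>\<^sub>M borel)"
    for f and N :: "'x measure"
    by (rule L.nn_integral_fst[symmetric]) measurable

  have kl: "kl_div (J i) (p i \<Otimes>\<^sub>M P i) \<le> ereal c" if "i < s" for i
    using MI[OF that] distr_fst_joint[OF Q p(2)[OF that]]
    by (simp add: MI_def mutual_inf_def J_def P_def)
  have pP_prob: "prob_space (p i \<Otimes>\<^sub>M P i)" if "i < s" for i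
    using that by (intro prob_space_pair p P_prob)
  have kl_fin: "kl_div (J i) (p i \<Otimes>\<^sub>M P i) < \<infinity>" if "i < s" for i
    using kl[OF that] by (rule le_less_trans) simp
  note kl_bounds = kl_div_bounds[OF J_prob pP_prob kl_fin]

  have "absolutely_continuous (m \<Otimes>\<^sub>M L) T"
    unfolding absolutely_continuous_def
  proof (rule subsetI)
    fix A assume "A \<in> null_sets (m \<Otimes>\<^sub>M L)"
    then have null: "emeasure (m \<Otimes>\<^sub>M L) A = 0" and "A \<in> sets (m \<Otimes>\<^sub>M L)" by (auto simp: null_sets_def)
    then have A [measurable]: "A \<in> sets (borel \<Otimes>\<^sub>M borel)"
      using sets_pair_measure_cong[OF m(1) L(1)] by simp
    have "emeasure (J i) A = 0" if i: "i < s" for i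
    proof -
      note [measurable_cong] = p(2)[OF i]
      interpret Pi: prob_space "P i" by (rule P_prob[OF i])
      have A': "A \<in> sets (p i \<Otimes>\<^sub>M P i)" by measurable
      have "emeasure (p i \<Otimes>\<^sub>M P i) A = (\<integral>\<^sup>+x. \<integral>\<^sup>+y. indicator A (x, y) \<partial>P i \<partial>p i)"
        using A' by (subst Pi.emeasure_pair_measure) auto
      also have "\<dots> \<le> (\<integral>\<^sup>+x. \<integral>\<^sup>+y. indicator A (x, y) \<partial>L \<partial>p i)"
      proof (rule nn_integral_mono)
        fix x
        have "(\<integral>\<^sup>+y. indicator A (x, y) \<partial>L) = (\<Sum>j<s. \<integral>\<^sup>+y. indicator A (x, y) \<partial>P j)"
          by (rule L_int) measurable
        then show "(\<integral>\<^sup>+y. indicator A (x, y) \<partial>P i) \<le> (\<integral>\<^sup>+y. indicator A (x, y) \<partial>L)"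
          using i member_le_sum[of i "{..<s}" "\<lambda>j. \<integral>\<^sup>+y. indicator A (x, y) \<partial>P j"] by simp
      qed
      also have "\<dots> \<le> (\<integral>\<^sup>+x. \<integral>\<^sup>+y. indicator A (x, y) \<partial>L \<partial>m)"
      proof -
        have "(\<integral>\<^sup>+x. \<integral>\<^sup>+y. indicator A (x, y) \<partial>L \<partial>m) = (\<Sum>j<s. \<integral>\<^sup>+x. \<integral>\<^sup>+y. indicator A (x, y) \<partial>L \<partial>p j)"
          by (rule m_int) measurable
        then show ?thesis
          using i member_le_sum[of i "{..<s}" "\<lambda>j. \<integral>\<^sup>+x. \<integral>\<^sup>+y. indicator A (x, y) \<partial>L \<partial>p j"] by simp
      qed
      also have "\<dots> = emeasure (m \<Otimes>\<^sub>M L) A"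
        by (rule L.emeasure_pair_measure[symmetric]) measurable
      finally have "A \<in> null_sets (p i \<Otimes>\<^sub>M P i)" using null A' by (auto simp: null_sets_def)
      then show ?thesis using kl_bounds(2)[OF i i i] by (auto simp: absolutely_continuous_def)
    qed
    moreover have "emeasure T A = (\<Sum>i<s. emeasure (J i) A)"
      unfolding T_def by (rule emeasure_measure_sum[where N=J, OF s J_prob J_sets A])
    ultimately show "A \<in> null_sets T" using A T(1) by (auto simp: null_sets_def)
  qed
  moreover have "sets T = sets (m \<Otimes>\<^sub>M L)"
    using sets_pair_measure_cong[OF m(1) L(1)] T(1) by simp
  ultimately have T_dens: "density (m \<Otimes>\<^sub>M L) (RN_deriv (m \<Otimes>\<^sub>M L) T) = T"
    and T_fin: "AE z in m \<Otimes>\<^sub>M L. RN_deriv (m \<Otimes>\<^sub>M L) T z \<noteq> \<infinity>"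
    using mL.P.density_RN_deriv mL.P.RN_deriv_finite[OF T.sigma_finite_measure_axioms] by auto
  define r where "r x y = enn2real (RN_deriv (m \<Otimes>\<^sub>M L) T (x, y))" for x y
  have "(\<lambda>z. RN_deriv (m \<Otimes>\<^sub>M L) T z) \<in> borel_measurable (m \<Otimes>\<^sub>M L)" by measurable
  then have [measurable]: "RN_deriv (m \<Otimes>\<^sub>M L) T \<in> borel_measurable (borel \<Otimes>\<^sub>M borel)"
    by (simp add: measurable_cong_sets[OF sets_pair_measure_cong[OF m(1) L(1)] refl])
  have r_meas [measurable]: "case_prod r \<in> borel_measurable (borel \<Otimes>\<^sub>M borel)"
    unfolding r_def[abs_def] by measurable
  have T_dens': "density (m \<Otimes>\<^sub>M L) (\<lambda>z. ennreal (r (fst z) (snd z))) = T"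
  proof -
    have "density (m \<Otimes>\<^sub>M L) (\<lambda>z. ennreal (r (fst z) (snd z))) = density (m \<Otimes>\<^sub>M L) (RN_deriv (m \<Otimes>\<^sub>M L) T)"
      using T_fin by (intro density_cong) (auto elim!: eventually_mono simp: r_def less_top)
    then show ?thesis using T_dens by simp
  qed
  have r_nonneg: "0 \<le> r x y" for x y by (simp add: r_def)

  text \<open>The density of the sum of the joint laws is a conditional density for each of them, because all
    of them share the kernel \<open>Q\<close>.\<close>
  have J_int: "(\<integral>\<^sup>+z. g z \<partial>J i) = (\<integral>\<^sup>+x. \<integral>\<^sup>+y. ennreal (r x y) * g (x, y) \<partial>L \<partial>p i)"
    if i: "i < s" and g [measurable]: "g \<in> borel_measurable (borel \<Otimes>\<^sub>M borel)" for i g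
  proof -
    interpret pi: prob_space "p i" by (rule p(1)[OF i])
    \<comment> \<open>Weighting by \<open>v\<close> turns an integral under \<open>p i\<close> into
      one under \<open>m\<close>, hence into a sum over all sources; with the common kernel this sum
      is an integral under \<open>T\<close>, where \<open>r\<close> is available.\<close>
    define v where "v = RN_deriv m (p i)"
    have v [measurable]: "v \<in> borel_measurable borel"
      using borel_measurable_RN_deriv[of m "p i"] by (simp add: v_def measurable_cong_sets[OF m(1) refl])
    have v_dens: "density m v = p i"
      unfolding v_def m_def
      using p(2)[OF i] m(1) absolutely_continuous_measure_sum[where N=p, OF s p, of i] i
      by (intro m.density_RN_deriv[unfolded m_def]) (auto simp: m_def)
    have int_v: "(\<integral>\<^sup>+x. g x \<partial>p i) = (\<integral>\<^sup>+x. v x * g x \<partial>m)" if "g \<in> borel_measurable borel" for g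
      unfolding v_dens[symmetric] using that by (intro nn_integral_density) measurable
    note [measurable] = kernels_subprob[OF Q]
    have gQ [measurable]: "(\<lambda>x. \<integral>\<^sup>+y. g (x, y) \<partial>Q x) \<in> borel_measurable borel"
      by (rule nn_integral_measurable_subprob_algebra2) measurable
    have [measurable]: "g \<in> borel_measurable borel" using g by (simp add: borel_prod)
    have "(\<integral>\<^sup>+z. g z \<partial>J i) = (\<integral>\<^sup>+x. \<integral>\<^sup>+y. g (x, y) \<partial>Q x \<partial>p i)"
      unfolding J_def by (rule nn_integral_joint[OF Q p(2)[OF i]]) measurable
    also have "\<dots> = (\<integral>\<^sup>+x. v x * (\<integral>\<^sup>+y. g (x, y) \<partial>Q x) \<partial>m)" by (rule int_v) measurable
    also have "\<dots> = (\<Sum>j<s. \<integral>\<^sup>+x. v x * (\<integral>\<^sup>+y. g (x, y) \<partial>Q x) \<partial>p j)" by (rule m_int) measurable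
    also have "\<dots> = (\<Sum>j<s. \<integral>\<^sup>+z. v (fst z) * g z \<partial>J j)"
    proof (rule sum.cong[OF refl])
      fix j assume "j \<in> {..<s}"
      then have j: "j < s" by simp
      have "(\<lambda>z. v (fst z) * g z) \<in> borel_measurable (borel \<Otimes>\<^sub>M borel)" by measurable
      then have "(\<integral>\<^sup>+z. v (fst z) * g z \<partial>J j) = (\<integral>\<^sup>+x. \<integral>\<^sup>+y. v x * g (x, y) \<partial>Q x \<partial>p j)"
        unfolding J_def by (subst nn_integral_joint[OF Q p(2)[OF j]]) (simp_all add: borel_prod)
      also have "\<dots> = (\<integral>\<^sup>+x. v x * (\<integral>\<^sup>+y. g (x, y) \<partial>Q x) \<partial>p j)"
      proof (rule nn_integral_cong)
        fix x
        note [measurable_cong] = kernels_prob(2)[OF Q, of x]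
        show "(\<integral>\<^sup>+y. v x * g (x, y) \<partial>Q x) = v x * (\<integral>\<^sup>+y. g (x, y) \<partial>Q x)"
          by (rule nn_integral_cmult) measurable
      qed
      finally show "(\<integral>\<^sup>+x. v x * (\<integral>\<^sup>+y. g (x, y) \<partial>Q x) \<partial>p j) = (\<integral>\<^sup>+z. v (fst z) * g z \<partial>J j)" ..
    qed
    also have "\<dots> = (\<integral>\<^sup>+z. v (fst z) * g z \<partial>T)" by (rule T_int[symmetric]) measurable
    also have "\<dots> = (\<integral>\<^sup>+z. ennreal (r (fst z) (snd z)) * (v (fst z) * g z) \<partial>(m \<Otimes>\<^sub>M L))"
      unfolding T_dens'[symmetric] by (rule nn_integral_density) measurable
    also have "\<dots> = (\<integral>\<^sup>+x. \<integral>\<^sup>+y. ennreal (r x y) * (v x * g (x, y)) \<partial>L \<partial>m)"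
      by (subst fubini[OF m(1)]) ((measurable)[1], simp)
    also have "\<dots> = (\<integral>\<^sup>+x. v x * (\<integral>\<^sup>+y. ennreal (r x y) * g (x, y) \<partial>L) \<partial>m)"
      by (intro nn_integral_cong) (subst nn_integral_cmult[symmetric], (measurable)[1], simp add: ac_simps)
    also have "\<dots> = (\<integral>\<^sup>+x. \<integral>\<^sup>+y. ennreal (r x y) * g (x, y) \<partial>L \<partial>p i)"
      by (rule int_v[symmetric]) measurable
    finally show ?thesis .
  qed
  have r_prob: "AE x in p i. (\<integral>\<^sup>+y. ennreal (r x y) \<partial>L) = 1" if i: "i < s" for i
  proof -
    interpret pi: prob_space "p i" by (rule p(1)[OF i])
    note [measurable_cong] = p(2)[OF i]
    \<comment> \<open>For test functions of \<open>x\<close> alone, \<open>J_int\<close> says that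
      the integral of \<open>r x\<close> over \<open>L\<close> is a density of \<open>p i\<close>
      with respect to itself.\<close>
    have "density (p i) (\<lambda>x. \<integral>\<^sup>+y. ennreal (r x y) \<partial>L) = density (p i) (\<lambda>x. 1)"
    proof (rule measure_eqI)
      fix A assume "A \<in> sets (density (p i) (\<lambda>x. \<integral>\<^sup>+y. ennreal (r x y) \<partial>L))"
      then have [measurable]: "A \<in> sets borel" using p(2)[OF i] by simp
      have "emeasure (p i) A = emeasure (distr (J i) borel fst) A"
        using distr_fst_joint[OF Q p(2)[OF i]] by (simp add: J_def)
      also have "\<dots> = (\<integral>\<^sup>+x. indicator A x \<partial>distr (J i) borel fst)" by simp
      also have "\<dots> = (\<integral>\<^sup>+z. indicator A (fst z) \<partial>J i)"
        by (rule nn_integral_distr) (simp_all add: measurable_cong_sets[OF J_sets[OF i] refl])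
      also have "\<dots> = (\<integral>\<^sup>+x. \<integral>\<^sup>+y. ennreal (r x y) * indicator A (fst (x, y)) \<partial>L \<partial>p i)"
        by (rule J_int[OF i]) measurable
      also have "\<dots> = (\<integral>\<^sup>+x. (\<integral>\<^sup>+y. ennreal (r x y) \<partial>L) * indicator A x \<partial>p i)"
        by (intro nn_integral_cong) (subst nn_integral_multc[symmetric], (measurable)[1], simp)
      also have "\<dots> = emeasure (density (p i) (\<lambda>x. \<integral>\<^sup>+y. ennreal (r x y) \<partial>L)) A"
        by (rule emeasure_density[symmetric]) measurable
      finally show "emeasure (density (p i) (\<lambda>x. \<integral>\<^sup>+y. ennreal (r x y) \<partial>L)) A = emeasure (density (p i) (\<lambda>x. 1)) A"
        by (simp add: density_1)
    qed simp
    then show ?thesis by (intro pi.density_unique) measurable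
  qed
  have conv: "(\<integral>\<^sup>+x. \<integral>\<^sup>+y. ennreal (cvx_potential (r x y)) \<partial>L \<partial>p i) \<le> ennreal (c * ln 2 + 1 / 2)" if i: "i < s" for i
  proof -
    interpret pi: prob_space "p i" by (rule p(1)[OF i])
    interpret Pi: prob_space "P i" by (rule P_prob[OF i])
    interpret pL: pair_sigma_finite "p i" L ..
    note [measurable_cong] = p(2)[OF i]
    define \<rho> where "\<rho> z = enn2real (RN_deriv (p i \<Otimes>\<^sub>M P i) (J i) z)" for z
    have "\<rho> \<in> borel_measurable (p i \<Otimes>\<^sub>M P i)" unfolding \<rho>_def[abs_def] by measurable
    then have \<rho> [measurable]: "\<rho> \<in> borel_measurable (borel \<Otimes>\<^sub>M borel)"
      by (simp add: measurable_cong_sets[OF sets_pair_measure_cong[OF p(2)[OF i] P_sets] refl])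
    have \<rho>_nonneg: "0 \<le> \<rho> z" for z by (simp add: \<rho>_def)
    have J_dens: "density (p i \<Otimes>\<^sub>M P i) (\<lambda>z. ennreal (\<rho> z)) = J i"
      unfolding \<rho>_def by (rule kl_bounds(3)[OF i i i])
    have to_P: "(\<integral>\<^sup>+z. ennreal (w i (snd z)) * g z \<partial>(p i \<Otimes>\<^sub>M L)) = (\<integral>\<^sup>+z. g z \<partial>(p i \<Otimes>\<^sub>M P i))"
      if [measurable]: "g \<in> borel_measurable (borel \<Otimes>\<^sub>M borel)" for g
    proof -
      have "(\<integral>\<^sup>+z. ennreal (w i (snd z)) * g z \<partial>(p i \<Otimes>\<^sub>M L))
          = (\<integral>\<^sup>+x. \<integral>\<^sup>+y. ennreal (w i y) * g (x, y) \<partial>L \<partial>p i)"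
        by (subst fubini[OF p(2)[OF i]]) ((measurable)[1], simp)
      also have "\<dots> = (\<integral>\<^sup>+x. \<integral>\<^sup>+y. g (x, y) \<partial>P i \<partial>p i)"
        by (intro nn_integral_cong int_w[OF i]) measurable
      also have "\<dots> = (\<integral>\<^sup>+z. g z \<partial>(p i \<Otimes>\<^sub>M P i))"
        by (rule Pi.nn_integral_fst) measurable
      finally show ?thesis .
    qed
    \<comment> \<open>Both sides represent \<open>J i\<close>: the left by \<open>J_int\<close>, the
      right by \<open>J_dens\<close> after expressing \<open>P i\<close> through \<open>L\<close>.
      The resulting factorisation of \<open>r\<close> is what \<open>cvx_potential_scale\<close>
      needs.\<close>
    have "density (p i \<Otimes>\<^sub>M L) (\<lambda>z. ennreal (r (fst z) (snd z)))
        = density (p i \<Otimes>\<^sub>M L) (\<lambda>z. ennreal (w i (snd z) * \<rho> z))"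
    proof (rule measure_eqI)
      fix A assume "A \<in> sets (density (p i \<Otimes>\<^sub>M L) (\<lambda>z. ennreal (r (fst z) (snd z))))"
      then have A [measurable]: "A \<in> sets (borel \<Otimes>\<^sub>M borel)"
        using sets_pair_measure_cong[OF p(2)[OF i] L(1)] by simp
      have "emeasure (density (p i \<Otimes>\<^sub>M L) (\<lambda>z. ennreal (r (fst z) (snd z)))) A
          = (\<integral>\<^sup>+z. ennreal (r (fst z) (snd z)) * indicator A z \<partial>(p i \<Otimes>\<^sub>M L))"
        by (rule emeasure_density) measurable
      also have "\<dots> = (\<integral>\<^sup>+x. \<integral>\<^sup>+y. ennreal (r x y) * indicator A (x, y) \<partial>L \<partial>p i)"
        by (subst fubini[OF p(2)[OF i]]) ((measurable)[1], simp)
      also have "\<dots> = (\<integral>\<^sup>+z. indicator A z \<partial>J i)"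
        by (rule J_int[OF i, symmetric]) measurable
      also have "\<dots> = (\<integral>\<^sup>+z. ennreal (\<rho> z) * indicator A z \<partial>(p i \<Otimes>\<^sub>M P i))"
        unfolding J_dens[symmetric] by (rule nn_integral_density) measurable
      also have "\<dots> = (\<integral>\<^sup>+z. ennreal (w i (snd z)) * (ennreal (\<rho> z) * indicator A z) \<partial>(p i \<Otimes>\<^sub>M L))"
        by (rule to_P[symmetric]) measurable
      also have "\<dots> = (\<integral>\<^sup>+z. ennreal (w i (snd z) * \<rho> z) * indicator A z \<partial>(p i \<Otimes>\<^sub>M L))"
        using w(2) \<rho>_nonneg by (simp add: ennreal_mult mult.assoc)
      also have "\<dots> = emeasure (density (p i \<Otimes>\<^sub>M L) (\<lambda>z. ennreal (w i (snd z) * \<rho> z))) A"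
        by (rule emeasure_density[symmetric]) measurable
      finally show "emeasure (density (p i \<Otimes>\<^sub>M L) (\<lambda>z. ennreal (r (fst z) (snd z)))) A
        = emeasure (density (p i \<Otimes>\<^sub>M L) (\<lambda>z. ennreal (w i (snd z) * \<rho> z))) A" .
    qed simp
    then have "AE z in p i \<Otimes>\<^sub>M L. ennreal (r (fst z) (snd z)) = ennreal (w i (snd z) * \<rho> z)"
      by (intro pL.P.density_unique) measurable
    then have AE_eq: "AE z in p i \<Otimes>\<^sub>M L. r (fst z) (snd z) = w i (snd z) * \<rho> z"
      using r_nonneg w(2) \<rho>_nonneg by simp
    have w_le: "w i y \<le> 1" for y
      using member_le_sum[of i "{..<s}" "\<lambda>i. w i y"] i w(2,3) by simp
    have "(\<integral>\<^sup>+x. \<integral>\<^sup>+y. ennreal (cvx_potential (r x y)) \<partial>L \<partial>p i)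
        = (\<integral>\<^sup>+z. ennreal (cvx_potential (r (fst z) (snd z))) \<partial>(p i \<Otimes>\<^sub>M L))"
      by (subst fubini[OF p(2)[OF i]]) ((measurable)[1], simp)
    also have "\<dots> \<le> (\<integral>\<^sup>+z. ennreal (w i (snd z)) * ennreal (cvx_potential (\<rho> z)) \<partial>(p i \<Otimes>\<^sub>M L))"
    proof (rule nn_integral_mono_AE)
      show "AE z in p i \<Otimes>\<^sub>M L. ennreal (cvx_potential (r (fst z) (snd z)))
          \<le> ennreal (w i (snd z)) * ennreal (cvx_potential (\<rho> z))"
        using AE_eq
      proof eventually_elim
        case (elim z)
        have "cvx_potential (w i (snd z) * \<rho> z) \<le> w i (snd z) * cvx_potential (\<rho> z)"
          by (intro cvx_potential_scale w w_le \<rho>_nonneg)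
        then show ?case
          using w(2) cvx_potential_nonneg[OF \<rho>_nonneg] by (simp add: elim ennreal_leI flip: ennreal_mult)
      qed
    qed
    also have "\<dots> = (\<integral>\<^sup>+z. ennreal (cvx_potential (\<rho> z)) \<partial>(p i \<Otimes>\<^sub>M P i))"
      by (rule to_P) measurable
    also have "\<dots> \<le> ennreal (c * ln 2 + 1 / 2)"
    proof -
      obtain c' where "kl_div (J i) (p i \<Otimes>\<^sub>M P i) = ereal c'"
        and le: "(\<integral>\<^sup>+z. ennreal (cvx_potential (\<rho> z)) \<partial>(p i \<Otimes>\<^sub>M P i)) \<le> ennreal (c' * ln 2 + 1 / 2)"
        using kl_bounds(4)[OF i i i] unfolding \<rho>_def by blast
      then have "c' \<le> c" using kl[OF i] by simp
      then show ?thesis by (intro order_trans[OF le] ennreal_leI) simp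
    qed
    finally show ?thesis .
  qed
  have w_prob: "(\<integral>\<^sup>+y. ennreal (w i y) \<partial>L) = 1" if i: "i < s" for i
    using int_w[OF i, of "\<lambda>_. 1"] prob_space.emeasure_space_1[OF P_prob[OF i]] by simp
  have J_emeasure: "emeasure (joint (p i) Q) A = (\<integral>\<^sup>+x. \<integral>\<^sup>+y. ennreal (r x y) * indicator A (x, y) \<partial>L \<partial>p i)"
    if i: "i < s" and A: "A \<in> sets borel" for i A
  proof -
    have "A \<in> sets (joint (p i) Q)" using A sets_joint[OF Q p(2)[OF i]] by simp
    then have "emeasure (joint (p i) Q) A = (\<integral>\<^sup>+z. indicator A z \<partial>joint (p i) Q)" by simp
    also have "\<dots> = (\<integral>\<^sup>+x. \<integral>\<^sup>+y. ennreal (r x y) * indicator A (x, y) \<partial>L \<partial>p i)"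
      using J_int[OF i, of "indicator A"] A unfolding borel_prod J_def by simp
    finally show ?thesis .
  qed
  show ?thesis
    by (rule that[OF L(2,1) w w_prob r_meas r_nonneg r_prob J_emeasure conv])
qed

section \<open>The robust code\<close>

lemma sum_mod_block:
  fixes f :: "nat \<Rightarrow> real"
  shows "(\<Sum>i\<in>{k * s..<k * s + s}. f (i mod s)) = (\<Sum>j<s. f j)"
proof (rule sum.reindex_bij_witness[where i="\<lambda>j. k * s + j" and j="\<lambda>i. i - k * s"])
  fix i assume i: "i \<in> {k * s..<k * s + s}"
  then have "i div s = k" by (intro div_nat_eqI) (auto simp: mult.commute)
  then have "i mod s = i - k * s" by (metis minus_div_mult_eq_mod)
  then show "f (i - k * s) = f (i mod s)" by simp
qed auto

text \<open>Establishes \<open>w_sum\<close>: each complete block has sum 1, and the nonnegative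
  terms of an unfinished block are dropped.\<close>

lemma sum_cyclic_ge:
  fixes f :: "nat \<Rightarrow> real"
  assumes "\<And>j. 0 \<le> f j" "(\<Sum>j<s. f j) = 1"
  shows "real (n div s) \<le> (\<Sum>i<n. f (i mod s))"
proof -
  have "real (n div s) = (\<Sum>k<n div s. \<Sum>i\<in>{k * s..<k * s + s}. f (i mod s))"
    by (simp add: sum_mod_block assms(2))
  also have "\<dots> = (\<Sum>i<n div s * s. f (i mod s))" by (rule sum.nat_group)
  also have "\<dots> \<le> (\<Sum>i<n. f (i mod s))"
    using assms(1) by (intro sum_mono2) (auto intro: less_le_trans[OF _ div_times_less_eq_dividend])
  finally show ?thesis .
qed

text \<open>The nat added to \<open>c\<close> in \<open>a\<close> consists of 1/2 from the survival
  part of \<open>expected_log_le\<close> and 1/2 from \<open>kl_div_bounds\<close>.\<close>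

lemma robust_code:
  fixes p :: "nat \<Rightarrow> 'x::polish_space measure" and Q :: "'x \<Rightarrow> 'y::polish_space measure"
  assumes s: "0 < s" and p: "\<And>i. i < s \<Longrightarrow> prob_space (p i)" "\<And>i. i < s \<Longrightarrow> sets (p i) = sets borel"
    and Q: "Q \<in> kernels" and c: "0 \<le> c" and MI: "\<And>i. i < s \<Longrightarrow> MI (p i) Q \<le> ereal c"
    and a: "a = c + 1 / ln 2"
  obtains f :: "'x \<Rightarrow> crand \<Rightarrow> nat" and g :: "nat \<Rightarrow> crand \<Rightarrow> 'y" and PZ :: "crand measure"
  where "prob_space PZ" "sets PZ = sets borel"
    and "(\<lambda>(x, z). f x z) \<in> borel \<rightarrow>\<^sub>M count_space UNIV"
    and "(\<lambda>(m, z). g m z) \<in> count_space UNIV \<Otimes>\<^sub>M borel \<rightarrow>\<^sub>M borel"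
    and "\<And>i. i < s \<Longrightarrow> cond_entropy_enc (p i) PZ f \<le> ennreal (log 2 (real s) + log 2 (1 + a) + a + 1)"
    and "\<And>i. i < s \<Longrightarrow> code_joint (p i) PZ f g = joint (p i) Q"
proof -
  obtain L :: "'y measure" and w :: "nat \<Rightarrow> 'y \<Rightarrow> real" and r :: "'x \<Rightarrow> 'y \<Rightarrow> real"
    where L: "finite_measure L" "sets L = sets borel"
    and w: "\<And>i. w i \<in> borel_measurable borel" "\<And>i y. 0 \<le> w i y" "\<And>y. (\<Sum>i<s. w i y) = 1"
      "\<And>i. i < s \<Longrightarrow> (\<integral>\<^sup>+y. ennreal (w i y) \<partial>L) = 1"
    and r [measurable]: "case_prod r \<in> borel_measurable (borel \<Otimes>\<^sub>M borel)" and r_nonneg: "\<And>x y. 0 \<le> r x y"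
    and r_prob: "\<And>i. i < s \<Longrightarrow> AE x in p i. (\<integral>\<^sup>+y. ennreal (r x y) \<partial>L) = 1"
    and r_joint: "\<And>i A. i < s \<Longrightarrow> A \<in> sets borel \<Longrightarrow>
        emeasure (joint (p i) Q) A = (\<integral>\<^sup>+x. \<integral>\<^sup>+y. ennreal (r x y) * indicator A (x, y) \<partial>L \<partial>p i)"
    and r_conv: "\<And>i. i < s \<Longrightarrow> (\<integral>\<^sup>+x. \<integral>\<^sup>+y. ennreal (cvx_potential (r x y)) \<partial>L \<partial>p i) \<le> ennreal (c * ln 2 + 1 / 2)"
    by (rule common_density[where p=p, OF s p Q MI], assumption+, rule that) blast+
  interpret L: finite_measure L by (rule L(1))
  note [measurable_cong] = L(2)
  define v where "v n = w (n mod s)" for n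
  have v_meas: "v n \<in> borel_measurable L" for n
    using w(1)[of "n mod s"] by (simp add: v_def)
  \<comment> \<open>The locale is entered only at those \<open>x\<close> where \<open>r x\<close> is
    normalised, which are almost all under every \<open>p i\<close>.\<close>
  have greedy: "greedy_rejection L v (r x) s" if "(\<integral>\<^sup>+y. ennreal (r x y) \<partial>L) = 1" for x
  proof (rule greedy_rejection.intro)
    show "finite_measure L" by (rule L(1))
    show "space L = UNIV" using sets_eq_imp_space_eq[OF L(2)] by simp
    show "v n \<in> borel_measurable L" for n by (rule v_meas)
    show "0 \<le> v n y" for n y by (simp add: v_def w)
    show "(\<integral>\<^sup>+y. ennreal (v n y) \<partial>L) = 1" for n using s by (simp add: v_def w)
    show "real (n div s) \<le> (\<Sum>i<n. v i y)" for n y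
      unfolding v_def by (rule sum_cyclic_ge) (rule w)+
    show "0 < s" by (rule s)
    show "r x \<in> borel_measurable L" by measurable
    show "0 \<le> r x y" for y by (rule r_nonneg)
  qed fact
  define \<Omega> where "\<Omega> = (\<Pi>\<^sub>M n\<in>UNIV. proposal L v n)"
  have prop_sets: "sets (proposal L v n) = sets borel" for n
  proof -
    have "sets (proposal L v n) = sets (borel \<Otimes>\<^sub>M (borel :: real measure))"
      unfolding proposal_def using L(2) by (intro sets_pair_measure_cong) auto
    then show ?thesis unfolding borel_prod .
  qed
  have \<Omega>_sets: "sets \<Omega> = sets (\<Pi>\<^sub>M n\<in>UNIV. borel)"
    unfolding \<Omega>_def by (intro sets_PiM_cong prop_sets) simp
  have \<Omega>_prob: "prob_space \<Omega>"
  proof -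
    \<comment> \<open>Some normalised \<open>r x\<close> exists, since under the probability measure
      \<open>p 0\<close> a property that fails everywhere cannot hold almost everywhere.\<close>
    obtain x where "(\<integral>\<^sup>+y. ennreal (r x y) \<partial>L) = 1"
    proof -
      interpret prob_space "p 0" by (rule p(1)[OF s])
      have "\<exists>x. (\<integral>\<^sup>+y. ennreal (r x y) \<partial>L) = 1"
      proof (rule ccontr)
        assume "\<nexists>x. (\<integral>\<^sup>+y. ennreal (r x y) \<partial>L) = 1"
        then have "AE x in p 0. False" using r_prob[OF s] by (auto elim: eventually_mono)
        then show False by simp
      qed
      then show ?thesis using that by blast
    qed
    then interpret greedy_rejection L v "r x" s by (rule greedy)
    show ?thesis unfolding \<Omega>_def by (rule prob_space_runs)
  qed
  obtain PZ :: "crand measure" and D :: "crand \<Rightarrow> nat \<Rightarrow> 'y \<times> real"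
    where PZ: "prob_space PZ" "sets PZ = sets borel" and D: "D \<in> borel \<rightarrow>\<^sub>M (\<Pi>\<^sub>M n\<in>UNIV. borel)"
      and D_distr: "distr PZ \<Omega> D = \<Omega>"
    using realize_in_crand[OF \<Omega>_prob \<Omega>_sets] by blast
  interpret Z: prob_space PZ by (rule PZ(1))
  note [measurable_cong] = PZ(2)
  have D_meas: "D \<in> PZ \<rightarrow>\<^sub>M \<Omega>"
    using D by (simp only: measurable_cong_sets[OF PZ(2) \<Omega>_sets])
  have transfer: "emeasure PZ {z. R (D z)} = emeasure \<Omega> {\<omega>. R \<omega>}"
    if "{\<omega> \<in> space \<Omega>. R \<omega>} \<in> sets \<Omega>" for R
  proof -
    have sp: "space \<Omega> = UNIV" "space PZ = UNIV"
      using sets_eq_imp_space_eq[OF \<Omega>_sets] sets_eq_imp_space_eq[OF PZ(2)] by (auto simp: space_PiM)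
    have "emeasure \<Omega> {\<omega>. R \<omega>} = emeasure (distr PZ \<Omega> D) {\<omega>. R \<omega>}" by (simp add: D_distr)
    also have "\<dots> = emeasure PZ (D -` {\<omega>. R \<omega>} \<inter> space PZ)"
      using that sp by (intro emeasure_distr D_meas) auto
    finally show ?thesis by (simp add: sp vimage_def)
  qed
  define f where "f x z = first_accept L v (r x) (D z)" for x z
  define g where "g n z = fst (D z n)" for n z

  have f_meas: "(\<lambda>(x, z). f x z) \<in> borel \<Otimes>\<^sub>M borel \<rightarrow>\<^sub>M count_space UNIV"
  proof -
    have "case_prod r \<in> borel_measurable (borel \<Otimes>\<^sub>M L)" by measurable
    from first_accept_measurable[OF L.sigma_finite_measure_axioms v_meas this]
    have raw: "(\<lambda>(x, \<omega>). first_accept L v (r x) \<omega>) \<in> borel \<Otimes>\<^sub>M (\<Pi>\<^sub>M n\<in>UNIV. L \<Otimes>\<^sub>M borel) \<rightarrow>\<^sub>M count_space UNIV" .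
    have prod_sets: "sets (\<Pi>\<^sub>M n\<in>(UNIV :: nat set). L \<Otimes>\<^sub>M (borel :: real measure)) = sets (\<Pi>\<^sub>M n\<in>(UNIV :: nat set). borel)"
    proof (rule sets_PiM_cong)
      have "sets (L \<Otimes>\<^sub>M (borel :: real measure)) = sets (borel \<Otimes>\<^sub>M borel)"
        using L(2) by (intro sets_pair_measure_cong) auto
      then show "sets (L \<Otimes>\<^sub>M (borel :: real measure)) = sets borel" unfolding borel_prod .
    qed simp
    have "(\<lambda>(x, \<omega>). first_accept L v (r x) \<omega>) \<in> borel \<Otimes>\<^sub>M (\<Pi>\<^sub>M n\<in>UNIV. borel) \<rightarrow>\<^sub>M count_space UNIV"
      using raw unfolding measurable_cong_sets[OF sets_pair_measure_cong[OF refl prod_sets] refl] .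
    moreover note [measurable] = D
    have "(\<lambda>(x, z). (x, D z)) \<in> borel \<Otimes>\<^sub>M borel \<rightarrow>\<^sub>M borel \<Otimes>\<^sub>M (\<Pi>\<^sub>M n\<in>UNIV. borel)" by measurable
    ultimately have "(\<lambda>q. case (case q of (x, z) \<Rightarrow> (x, D z)) of (x, \<omega>) \<Rightarrow> first_accept L v (r x) \<omega>)
        \<in> borel \<Otimes>\<^sub>M borel \<rightarrow>\<^sub>M count_space UNIV" by (rule measurable_compose[rotated])
    then show ?thesis by (simp add: f_def split_beta)
  qed
  have g_meas: "(\<lambda>(n, z). g n z) \<in> count_space UNIV \<Otimes>\<^sub>M borel \<rightarrow>\<^sub>M borel"
  proof (rule measurable_pair_measure_countable1)
    fix n
    have "(fst :: 'y \<times> real \<Rightarrow> 'y) \<in> borel_measurable borel"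
      by (intro borel_measurable_continuous_onI continuous_intros)
    moreover have "(\<lambda>z. D z n) \<in> borel_measurable borel"
      using measurable_compose[OF D measurable_component_singleton[OF UNIV_I]] .
    ultimately show "(\<lambda>z. case (n, z) of (n, z) \<Rightarrow> g n z) \<in> borel_measurable borel"
      unfolding g_def by (simp add: measurable_compose)
  qed simp
  have out_meas: "(\<lambda>(x, z). (x, g (f x z) z)) \<in> borel \<Otimes>\<^sub>M borel \<rightarrow>\<^sub>M borel"
  proof -
    note [measurable] = f_meas g_meas
    have "(\<lambda>q. (f (fst q) (snd q), snd q)) \<in> borel \<Otimes>\<^sub>M borel \<rightarrow>\<^sub>M count_space UNIV \<Otimes>\<^sub>M borel" by measurable
    from measurable_compose[OF this g_meas]
    have "(\<lambda>q. g (f (fst q) (snd q)) (snd q)) \<in> borel \<Otimes>\<^sub>M borel \<rightarrow>\<^sub>M borel" by simp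
    then have "(\<lambda>q. (fst q, g (f (fst q) (snd q)) (snd q))) \<in> borel \<Otimes>\<^sub>M borel \<rightarrow>\<^sub>M borel"
      by (intro borel_measurable_Pair) measurable
    then show ?thesis by (simp add: split_beta)
  qed

  have law: "code_joint (p i) PZ f g = joint (p i) Q" if i: "i < s" for i
  proof (rule measure_eqI)
    show "sets (code_joint (p i) PZ f g) = sets (joint (p i) Q)"
      by (simp add: code_joint_def sets_joint[OF Q p(2)[OF i]])
    fix A assume "A \<in> sets (code_joint (p i) PZ f g)"
    then have A [measurable]: "A \<in> sets borel" by (simp add: code_joint_def)
    note [measurable_cong] = p(2)[OF i]
    note [measurable] = out_meas
    let ?out = "\<lambda>(x, z). (x, g (f x z) z)"
    have sp: "space (p i) = UNIV" "space PZ = UNIV"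
      using sets_eq_imp_space_eq[OF p(2)[OF i]] sets_eq_imp_space_eq[OF PZ(2)] by auto
    have out: "?out \<in> p i \<Otimes>\<^sub>M PZ \<rightarrow>\<^sub>M borel" by measurable
    have "emeasure (code_joint (p i) PZ f g) A = emeasure (p i \<Otimes>\<^sub>M PZ) (?out -` A)"
      unfolding code_joint_def using emeasure_distr[OF out A] by (simp add: space_pair_measure sp)
    also have "\<dots> = (\<integral>\<^sup>+x. emeasure PZ (Pair x -` (?out -` A)) \<partial>p i)"
      using measurable_sets[OF out A] by (intro Z.emeasure_pair_measure_alt) (simp add: space_pair_measure sp)
    also have "\<dots> = (\<integral>\<^sup>+x. \<integral>\<^sup>+y. ennreal (r x y) * indicator A (x, y) \<partial>L \<partial>p i)"
    proof (rule nn_integral_cong_AE)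
      show "AE x in p i. emeasure PZ (Pair x -` (?out -` A)) = (\<integral>\<^sup>+y. ennreal (r x y) * indicator A (x, y) \<partial>L)"
        using r_prob[OF i]
      proof eventually_elim
        case (elim x)
        interpret greedy_rejection L v "r x" s by (rule greedy[OF elim])
        have "Pair x \<in> borel_measurable (borel :: 'y measure)"
          by (intro borel_measurable_continuous_onI continuous_intros)
        from measurable_sets[OF this A] have Ax [measurable]: "{y. (x, y) \<in> A} \<in> sets L"
          by (simp add: L(2) vimage_def)
        have "(\<lambda>\<omega>. fst (\<omega> (first_accept L v (r x) \<omega>))) \<in> \<Omega> \<rightarrow>\<^sub>M L"
          unfolding \<Omega>_def by (rule measurable_compose_countable[OF fst_component first_accept_component])
        from measurable_sets[OF this Ax]
        have "{\<omega> \<in> space \<Omega>. fst (\<omega> (first_accept L v (r x) \<omega>)) \<in> {y. (x, y) \<in> A}} \<in> sets \<Omega>"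
          by (simp add: vimage_def Int_def conj_commute)
        from transfer[OF this] emeasure_selected[OF Ax]
        have "emeasure PZ {z. fst (D z (first_accept L v (r x) (D z))) \<in> {y. (x, y) \<in> A}}
            = (\<integral>\<^sup>+y. ennreal (r x y) * indicator {y. (x, y) \<in> A} y \<partial>L)"
          unfolding \<Omega>_def by simp
        then show ?case by (simp add: vimage_def f_def g_def indicator_def)
      qed
    qed
    also have "\<dots> = emeasure (joint (p i) Q) A" by (rule r_joint[OF i A, symmetric])
    finally show "emeasure (code_joint (p i) PZ f g) A = emeasure (joint (p i) Q) A" .
  qed

  have entropy: "cond_entropy_enc (p i) PZ f \<le> ennreal (log 2 (real s) + log 2 (1 + a) + a + 1)" if i: "i < s" for i
  proof (rule cond_entropy_enc_le_log_moment[OF p(1)[OF i] PZ(1) _ s])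
    note [measurable_cong] = p(2)[OF i]
    show a_pos: "0 < a" using a c by (simp add: add_nonneg_pos)
    note [measurable] = f_meas
    show f_meas': "(\<lambda>(x, z). f x z) \<in> p i \<Otimes>\<^sub>M PZ \<rightarrow>\<^sub>M count_space UNIV" by measurable
    interpret pi: prob_space "p i" by (rule p(1)[OF i])
    have sp: "space (p i) = UNIV" "space PZ = UNIV"
      using sets_eq_imp_space_eq[OF p(2)[OF i]] sets_eq_imp_space_eq[OF PZ(2)] by auto
    let ?F = "\<lambda>m. {q \<in> space (p i \<Otimes>\<^sub>M PZ). f (fst q) (snd q) = m}"
    have F: "?F m \<in> sets (p i \<Otimes>\<^sub>M PZ)" for m
      using measurable_sets[OF f_meas', of "{m}"] by (simp add: vimage_def Int_def split_beta conj_commute)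
    \<comment> \<open>By Fubini the moment is the average over \<open>x\<close> of the quantity that
      \<open>expected_log_le\<close> bounds for a fixed \<open>x\<close>.\<close>
    have "(\<Sum>m. ennreal (ln (real (m div s + 1))) * emeasure (p i \<Otimes>\<^sub>M PZ) (?F m))
        = (\<Sum>m. \<integral>\<^sup>+x. ennreal (ln (real (m div s + 1))) * emeasure PZ (Pair x -` ?F m) \<partial>p i)"
      using Z.measurable_emeasure_Pair[OF F]
      by (intro suminf_cong) (simp add: Z.emeasure_pair_measure_alt[OF F] nn_integral_cmult)
    also have "\<dots> = (\<integral>\<^sup>+x. (\<Sum>m. ennreal (ln (real (m div s + 1))) * emeasure PZ (Pair x -` ?F m)) \<partial>p i)"
      using Z.measurable_emeasure_Pair[OF F] by (intro nn_integral_suminf[symmetric]) simp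
    also have "\<dots> \<le> (\<integral>\<^sup>+x. ennreal (1 / 2) + (\<integral>\<^sup>+y. ennreal (cvx_potential (r x y)) \<partial>L) \<partial>p i)"
    proof (rule nn_integral_mono_AE)
      show "AE x in p i. (\<Sum>m. ennreal (ln (real (m div s + 1))) * emeasure PZ (Pair x -` ?F m))
          \<le> ennreal (1 / 2) + (\<integral>\<^sup>+y. ennreal (cvx_potential (r x y)) \<partial>L)"
        using r_prob[OF i]
      proof eventually_elim
        case (elim x)
        interpret greedy_rejection L v "r x" s by (rule greedy[OF elim])
        have "emeasure PZ (Pair x -` ?F m) = ennreal (\<sigma> m - \<sigma> (Suc m))" for m
        proof -
          have "{\<omega> \<in> space \<Omega>. first_accept L v (r x) \<omega> = m} \<in> sets \<Omega>"
            using measurable_sets[OF first_accept_component, of "{m}"]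
            by (simp add: \<Omega>_def vimage_def Int_def conj_commute)
          from transfer[OF this] emeasure_first_accept_eq[of m]
          have "emeasure PZ {z. first_accept L v (r x) (D z) = m} = ennreal (\<sigma> m - \<sigma> (Suc m))"
            unfolding \<Omega>_def by simp
          then show ?thesis by (simp add: f_def vimage_def space_pair_measure sp)
        qed
        then have "(\<Sum>m. ennreal (ln (real (m div s + 1))) * emeasure PZ (Pair x -` ?F m))
            = (\<Sum>m. ennreal (ln (real (m div s + 1)) * (\<sigma> m - \<sigma> (Suc m))))"
          by (intro suminf_cong) (simp add: ennreal_mult')
        also have "\<dots> \<le> ennreal (1 / 2) + (\<integral>\<^sup>+y. ennreal (cvx_potential (r x y)) \<partial>L)"
          by (rule expected_log_le)
        finally show ?case .
      qed
    qed
    also have "\<dots> = ennreal (1 / 2) + (\<integral>\<^sup>+x. \<integral>\<^sup>+y. ennreal (cvx_potential (r x y)) \<partial>L \<partial>p i)"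
      by (subst nn_integral_add) (simp_all add: pi.emeasure_space_1)
    also have "\<dots> \<le> ennreal (1 / 2) + ennreal (c * ln 2 + 1 / 2)"
      by (intro add_left_mono r_conv i)
    also have "\<dots> = ennreal (1 / 2 + (c * ln 2 + 1 / 2))"
      by (rule ennreal_plus[symmetric]) (use c in auto)
    also have "1 / 2 + (c * ln 2 + 1 / 2) = a * ln 2"
      by (simp add: a field_simps)
    finally show "(\<Sum>m. ennreal (ln (real (m div s + 1))) * emeasure (p i \<Otimes>\<^sub>M PZ) (?F m)) \<le> ennreal (a * ln 2)" .
  qed

  have "(\<lambda>(x, z). f x z) \<in> borel \<rightarrow>\<^sub>M count_space UNIV"
    using f_meas unfolding borel_prod .
  then show ?thesis by (rule that[OF PZ _ g_meas entropy law])
qed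

lemma MI_nonneg:
  assumes Q: "Q \<in> kernels" and \<mu>: "prob_space \<mu>" "sets \<mu> = sets borel"
  shows "0 \<le> MI \<mu> Q"
  unfolding MI_def mutual_inf_def
proof (rule kl_div_nonneg)
  note sets = measurable_cong_sets[OF sets_joint[OF Q \<mu>(2)] refl]
  show J: "prob_space (joint \<mu> Q)" by (rule prob_space_joint[OF Q \<mu>(2,1)])
  have "fst \<in> joint \<mu> Q \<rightarrow>\<^sub>M borel" "snd \<in> joint \<mu> Q \<rightarrow>\<^sub>M borel"
    unfolding sets by (intro borel_measurable_continuous_onI continuous_intros)+
  then show "prob_space (distr (joint \<mu> Q) borel fst \<Otimes>\<^sub>M distr (joint \<mu> Q) borel snd)"
    by (intro prob_space_pair prob_space.prob_space_distr J)
qed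

text \<open>Here 1 + a \<le> \<rho> + 13/5 \<le> 13/5 (\<rho> + 1), and (13/5)^5 \<le> 2^7 bounds
  the binary logarithm of 13/5 by 7/5. The constant is 4 = 7/5 + 8/5 + 1.\<close>

lemma log2_rate_bound:
  fixes \<rho> a :: real
  assumes \<rho>: "0 \<le> \<rho>" and a: "0 \<le> a" "a \<le> \<rho> + 8 / 5"
  shows "log 2 (1 + a) + a + 1 \<le> \<rho> + log 2 (\<rho> + 1) + 4"
proof -
  have "5 * log 2 (13 / 5) = log 2 ((13 / 5) ^ 5)" by (simp add: log_nat_power)
  also have "\<dots> \<le> log 2 (2 ^ 7)" by (subst log_le_cancel_iff) (simp_all add: power_divide)
  also have "\<dots> = 7" using log_nat_power[of 2 2 7] by simp
  finally have "log 2 (13 / 5) \<le> 7 / 5" by simp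
  moreover have "log 2 (1 + a) \<le> log 2 (13 / 5 * (\<rho> + 1))"
    using assms by (subst log_le_cancel_iff) auto
  moreover have "log 2 (13 / 5 * (\<rho> + 1)) = log 2 (13 / 5) + log 2 (\<rho> + 1)"
    using \<rho> by (subst log_mult) simp_all
  ultimately show ?thesis using a by linarith
qed

theorem theorem3:
  fixes S :: "'x::polish_space measure set"
    and M :: nat
    and h :: "nat \<Rightarrow> ('x \<times> 'y::polish_space) measure \<Rightarrow> real"
    and \<theta> :: "nat \<Rightarrow> real"
    and R :: real
  assumes "finite S"
    and "\<forall>\<mu>\<in>S. prob_space \<mu> \<and> sets \<mu> = sets borel"
    and "\<exists>Q\<in>Lset S M h \<theta>. Ibar S Q < \<infinity>"
    and "R \<ge> real_of_ereal (Rbar S M h \<theta>)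
              + log 2 (real (card S) * (real_of_ereal (Rbar S M h \<theta>) + 1)) + 4"
  shows "robust_achievable S M h \<theta> R"
proof (cases "S = {}")
  case True
  \<comment> \<open>No source imposes a condition, so a constant code with deterministic randomness
    serves.\<close>
  define PZ :: "crand measure" where "PZ = return borel (\<lambda>_. 0)"
  have "prob_space PZ" "sets PZ = sets borel" unfolding PZ_def by (simp_all add: prob_space_return)
  then show ?thesis
    unfolding robust_achievable_def True
    by (intro exI[of _ "\<lambda>_ _. 0"] exI[of _ "\<lambda>_ _. undefined"] exI[of _ PZ]) simp
next
  case False
  define s where "s = card S"
  have s: "0 < s" using False assms(1) by (simp add: s_def card_gt_0_iff)
  obtain p where p_bij: "bij_betw p {0..<s} S"
    using ex_bij_betw_nat_finite[OF assms(1)] unfolding s_def by blast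
  have pS: "p i \<in> S" if "i < s" for i using p_bij that by (auto simp: bij_betw_def)
  have p_prob: "prob_space (p i)" and p_sets: "sets (p i) = sets borel" if "i < s" for i
    using assms(2) pS[OF that] by auto
  have kernel: "Q \<in> kernels" if "Q \<in> Lset S M h \<theta>" for Q using that by (simp add: Lset_def)
  \<comment> \<open>Together with finiteness this makes \<open>real_of_ereal\<close> in the rate
    hypothesis the true value of \<open>Rbar\<close>.\<close>
  have "0 \<le> Rbar S M h \<theta>"
    unfolding Rbar_def
  proof (rule INF_greatest)
    fix Q assume Q: "Q \<in> Lset S M h \<theta>"
    have "0 \<le> MI (p 0) Q" using s by (intro MI_nonneg kernel[OF Q] p_prob p_sets) auto
    also have "\<dots> \<le> Ibar S Q" unfolding Ibar_def by (rule SUP_upper[OF pS[OF s]])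
    finally show "0 \<le> Ibar S Q" .
  qed
  moreover have "Rbar S M h \<theta> < \<infinity>"
  proof -
    obtain Q where Q: "Q \<in> Lset S M h \<theta>" "Ibar S Q < \<infinity>" using assms(3) by blast
    have "Rbar S M h \<theta> \<le> Ibar S Q" unfolding Rbar_def by (rule INF_lower[OF Q(1)])
    then show ?thesis using Q(2) by (rule le_less_trans)
  qed
  ultimately obtain \<rho> where \<rho>: "Rbar S M h \<theta> = ereal \<rho>" "0 \<le> \<rho>"
    by (cases "Rbar S M h \<theta>") auto
  \<comment> \<open>The slack 1/10 is what remains between one nat, at most 3/2 bits, and the 8/5
    bits allowed by \<open>log2_rate_bound\<close>.\<close>
  have "Rbar S M h \<theta> < ereal (\<rho> + 1 / 10)" by (simp add: \<rho>)
  then obtain Q where Q: "Q \<in> Lset S M h \<theta>" and Ibar: "Ibar S Q < ereal (\<rho> + 1 / 10)"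
    unfolding Rbar_def by (auto simp: INF_less_iff)
  define c where "c = \<rho> + 1 / 10"
  have c: "0 \<le> c" using \<rho> by (simp add: c_def)
  have MI: "MI (p i) Q \<le> ereal c" if "i < s" for i
  proof -
    have "MI (p i) Q \<le> Ibar S Q" unfolding Ibar_def by (rule SUP_upper[OF pS[OF that]])
    then show ?thesis using Ibar by (simp add: c_def)
  qed
  define a where "a = c + 1 / ln 2"
  obtain f :: "'x \<Rightarrow> crand \<Rightarrow> nat" and g :: "nat \<Rightarrow> crand \<Rightarrow> 'y" and PZ :: "crand measure"
    where PZ: "prob_space PZ" "sets PZ = sets borel"
      and f: "(\<lambda>(x, z). f x z) \<in> borel \<rightarrow>\<^sub>M count_space UNIV"
      and g: "(\<lambda>(m, z). g m z) \<in> count_space UNIV \<Otimes>\<^sub>M borel \<rightarrow>\<^sub>M borel"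
      and ent: "\<And>i. i < s \<Longrightarrow> cond_entropy_enc (p i) PZ f \<le> ennreal (log 2 (real s) + log 2 (1 + a) + a + 1)"
      and law: "\<And>i. i < s \<Longrightarrow> code_joint (p i) PZ f g = joint (p i) Q"
    by (rule robust_code[where p=p, OF s p_prob p_sets kernel[OF Q] c MI a_def], assumption+, rule that) blast+
  have "1 / ln 2 \<le> (3 / 2 :: real)" using ln2_ge_two_thirds by (simp add: field_simps)
  then have a: "0 \<le> a" "a \<le> \<rho> + 8 / 5" using c by (auto simp: a_def c_def)
  have "log 2 (real s) + log 2 (1 + a) + a + 1 \<le> log 2 (real s) + (\<rho> + log 2 (\<rho> + 1) + 4)"
    using log2_rate_bound[OF \<rho>(2) a] by simp
  also have "\<dots> = \<rho> + log 2 (real s * (\<rho> + 1)) + 4"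
    using s \<rho> by (simp add: log_mult)
  also have "\<dots> \<le> R" using assms(4) \<rho> by (simp add: s_def)
  finally have rate: "log 2 (real s) + log 2 (1 + a) + a + 1 \<le> R" .
  have nonneg: "0 \<le> log 2 (real s) + log 2 (1 + a) + a + 1" using s a by simp
  have "enn2ereal (cond_entropy_enc \<mu> PZ f) \<le> ereal R \<and> (\<forall>i<M. h i (code_joint \<mu> PZ f g) \<le> \<theta> i)"
    if \<mu>: "\<mu> \<in> S" for \<mu>
  proof -
    obtain j where j: "j < s" "\<mu> = p j" using \<mu> p_bij by (auto simp: bij_betw_def)
    have "enn2ereal (cond_entropy_enc \<mu> PZ f) \<le> enn2ereal (ennreal (log 2 (real s) + log 2 (1 + a) + a + 1))"
      using ent[OF j(1)] by (simp add: j(2) less_eq_ennreal.rep_eq)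
    also have "\<dots> \<le> ereal R" using rate nonneg by (simp add: enn2ereal_ennreal)
    finally have "enn2ereal (cond_entropy_enc \<mu> PZ f) \<le> ereal R" .
    moreover have "\<forall>i<M. h i (code_joint \<mu> PZ f g) \<le> \<theta> i"
      using Q \<mu> law[OF j(1)] by (simp add: Lset_def j(2))
    ultimately show ?thesis by blast
  qed
  then show ?thesis
    unfolding robust_achievable_def using PZ f g by blast
qed

end
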